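(* (1) Let $m\ge 0$ be an integer and let $Y$ be any (Borel) probability distribution on the standard simplex $\Delta^m$. For $l\ge 1$ let $\widehat{Y}_l$ be the random vector in $\Delta^m$ obtained by sampling $y\sim Y$, then sampling $\alpha=(\alpha_0,\ldots,\alpha_m)$ from the multinomial distribution with $l$ trials and probability vector $y$, and then sampling $\widehat{Y}_l$ from the Dirichlet distribution with parameters $(\alpha_0+1,\ldots,\alpha_m+1)$. Then the sequence $\widehat{Y}_l$ converges weakly to $Y$ as $l\to\infty$. In particular, the set $R_m^+$ (finite mixtures of Dirichlet distributions on $\Delta^m$ with positive integer parameters) is dense in the space of all probability distributions on $\Delta^m$ with respect to weak convergence. (2) Let $n\geq 1$ and let $X$ be any probability distribution on $\mathbb{R}^n$ with bounded support. Then $X$ can be approximated arbitrarily closely, with respect to weak convergence, by a simplicial mixture model with $n+1$ vertices; that is, there is a sequence of simplicial mixture models, each with $n+1$ vertices in $\mathbb{R}^n$ (where the dimension $k$ of the simplices used may vary along the sequence), converging weakly to $X$.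
   Context: The standard simplex is $\Delta^m=\{(z_0,\ldots,z_m)\in\mathbb{R}^{m+1} : z_j\ge 0,\ \sum_j z_j=1\}$, equipped with Lebesgue measure scaled so that its total volume is $1/m!$. With respect to this measure the Dirichlet distribution with parameters $\alpha=(\alpha_0,\ldots,\alpha_m)$, $\alpha_j>0$, has density $\frac{1}{B(\alpha)}\prod_{j=0}^m z_j^{\alpha_j-1}$, where $B(\alpha)=\prod_j\Gamma(\alpha_j)/\Gamma(\sum_j\alpha_j)$. Let $R_m=\mathbb{R}[z_0,\ldots,z_m]/(z_0+\cdots+z_m-1)$ be the algebra of polynomial functions on $\Delta^m$. $R_m^+\subset R_m$ is the convex subset of elements that can be expressed as polynomials in $z_0,\ldots,z_m$ with non-negative coefficients and that integrate to $1$ over $\Delta^m$. Each element of $R_m^+$ is identified with the probability distribution on $\Delta^m$ having it as density; these are exactly the finite mixtures of Dirichlet distributions with positive integer parameters. Simplicial mixture models. For integers $k\ge 0$, $M\ge1$, a combinatorial $k$-simplex on $M$ vertices is a multi-set of $k+1$ elements of $\{1,\ldots,M\}$, written as $S=(i_0\le\cdots\le i_k)$ (repetitions allowed); $A_k(M)$ is the set of all of them. Each $S=(i_0\le\cdots\le i_k)\in A_k(M)$ defines a random vector $U_S\in\mathbb{R}^M$: sample uniformly from $\Delta^k\subset\mathbb{R}^{k+1}$ and apply the linear map $\mathbb{R}^{k+1}\to\mathbb{R}^M$ sending the $j$-th standard basis vector to $e_{i_j}$ ($j=0,\ldots,k$). Given a real $n\times M$ matrix $V$ (whose columns are the vertices)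 and a probability distribution $\mathbf{p}$ on $A_k(M)$, the simplicial mixture model with parameters $(\mathbf{p},V)$, with $M$ vertices, is the random vector $X=VU_C$ in $\mathbb{R}^n$, where $C$ is a random element of $A_k(M)$ with distribution $\mathbf{p}$ and, conditionally on $C=S$, $U_C$ is distributed as $U_S$. *)

theory Defs
  imports
    "HOL-Probability.Probability"
    "HOL-Homology.Simplices"
    "HOL-Library.Poly_Mapping"
    "HOL-Library.Multiset"
begin

section \<open>Borel probability distributions and weak convergence\<close>

definition borel_prob :: "'a::topological_space set \<Rightarrow> 'a measure set" where
  "borel_prob T = space (prob_algebra (restrict_space borel T))"

definition weak_conv_on ::
    "'a::topological_space set \<Rightarrow> (nat \<Rightarrow> 'a measure) \<Rightarrow> 'a measure \<Rightarrow> bool" where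
  "weak_conv_on T N L \<longleftrightarrow>
     L \<in> borel_prob T \<and> (\<forall>l. N l \<in> borel_prob T) \<and>
     (\<forall>f :: 'a \<Rightarrow> real. continuous_on T f \<longrightarrow> bounded (f ` T) \<longrightarrow>
        (\<lambda>l. \<integral>x. f x \<partial>N l) \<longlonglongrightarrow> (\<integral>x. f x \<partial>L))"

text \<open>
  Density is understood sequentially. This implies (and, on a compact metrizable space such as
  a simplex, is equivalent to) density in the topology of weak convergence.
\<close>

definition weakly_dense_on :: "'a::topological_space set \<Rightarrow> 'a measure set \<Rightarrow> bool" where
  "weakly_dense_on T D \<longleftrightarrow>
     D \<subseteq> borel_prob T \<and>
     (\<forall>L \<in> borel_prob T. \<exists>N. (\<forall>l. N l \<in> D) \<and> weak_conv_on T N L)"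

definition measure_support :: "'a::topological_space measure \<Rightarrow> 'a set" where
  "measure_support L = {x. \<forall>U. open U \<and> x \<in> U \<longrightarrow> emeasure L U > 0}"


section \<open>Lebesgue measure and Dirichlet distributions on the simplex\<close>

text \<open>
  Points of \<open>\<real>\<^bsup>m+1\<^esup>\<close> are functions \<open>nat \<Rightarrow> real\<close> vanishing beyond \<open>m\<close>; the product topology
  on \<open>nat \<Rightarrow> real\<close> restricts to the Euclidean topology on \<^const>\<open>standard_simplex\<close> \<open>m\<close>.
  Lebesgue measure on the simplex is transported along the affine chart that omits \<open>z\<^sub>0\<close>:
  any affine chart gives Lebesgue measure up to a constant factor, and this one gives the factor
  for which the total volume is \<open>1/m!\<close> (see below).
\<close>

definition simplex_chart_domain :: "nat \<Rightarrow> (nat \<Rightarrow> real) set" where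
  "simplex_chart_domain m =
     {x \<in> space (\<Pi>\<^sub>M i\<in>{1..m}. lborel). (\<forall>i\<in>{1..m}. 0 \<le> x i) \<and> (\<Sum>i=1..m. x i) \<le> 1}"

definition simplex_chart :: "nat \<Rightarrow> (nat \<Rightarrow> real) \<Rightarrow> (nat \<Rightarrow> real)" where
  "simplex_chart m x =
     (\<lambda>j. if j = 0 then 1 - (\<Sum>i=1..m. x i) else if j \<le> m then x j else 0)"

definition simplex_measure :: "nat \<Rightarrow> (nat \<Rightarrow> real) measure" where
  "simplex_measure m =
     distr (restrict_space (\<Pi>\<^sub>M i\<in>{1..m}. lborel) (simplex_chart_domain m))
           (restrict_space borel (standard_simplex m)) (simplex_chart m)"

lemma simplex_chart_domain_sets: "simplex_chart_domain m \<in> sets (\<Pi>\<^sub>M i\<in>{1..m}. lborel)"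
proof -
  have "simplex_chart_domain m =
          Pi\<^sub>E {1..m} (\<lambda>_. {0..}) \<inter> (\<lambda>x. \<Sum>i=1..m. x i) -` {..1} \<inter> space (\<Pi>\<^sub>M i\<in>{1..m}. lborel)"
    by (auto simp: simplex_chart_domain_def space_PiM)
  also have "\<dots> \<in> sets (\<Pi>\<^sub>M i\<in>{1..m}. lborel)"
    by measurable
  finally show ?thesis .
qed

lemma simplex_chart_in_simplex:
  assumes "x \<in> simplex_chart_domain m"
  shows "simplex_chart m x \<in> standard_simplex m"
proof -
  have nn: "0 \<le> x i" if "i \<in> {1..m}" for i
    using assms that by (auto simp: simplex_chart_domain_def)
  have s1: "(\<Sum>i=1..m. x i) \<le> 1"
    using assms by (auto simp: simplex_chart_domain_def)
  have le1: "x i \<le> 1" if "i \<in> {1..m}" for i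
    using member_le_sum[of i "{1..m}" x] nn s1 that by fastforce
  have "(\<Sum>i\<le>m. simplex_chart m x i) = simplex_chart m x 0 + (\<Sum>i=1..m. simplex_chart m x i)"
    by (simp add: sum.atLeast_Suc_atMost atMost_atLeast0)
  also have "(\<Sum>i=1..m. simplex_chart m x i) = (\<Sum>i=1..m. x i)"
    by (intro sum.cong) (auto simp: simplex_chart_def)
  finally have "(\<Sum>i\<le>m. simplex_chart m x i) = 1"
    by (simp add: simplex_chart_def)
  moreover have "0 \<le> (\<Sum>i=1..m. x i)"
    using nn by (intro sum_nonneg) auto
  ultimately show ?thesis
    using nn le1 s1 unfolding standard_simplex_def by (auto simp: simplex_chart_def)
qed

lemma simplex_chart_measurable:
  "simplex_chart m \<in> restrict_space (\<Pi>\<^sub>M i\<in>{1..m}. lborel) (simplex_chart_domain m)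
     \<rightarrow>\<^sub>M restrict_space borel (standard_simplex m)"
proof (intro measurable_restrict_space3)
  have "(\<lambda>x. simplex_chart m x j) \<in> borel_measurable (\<Pi>\<^sub>M i\<in>{1..m}. lborel)" for j
    unfolding simplex_chart_def
    by (cases "j = 0"; cases "j \<le> m"; simp; measurable; auto)
  then show "simplex_chart m \<in> borel_measurable (\<Pi>\<^sub>M i\<in>{1..m}. lborel)"
    by (rule measurable_coordinatewise_then_product)
qed (use simplex_chart_in_simplex in auto)

lemma emeasure_simplex_measure:
  "emeasure (simplex_measure m) (standard_simplex m) = ennreal (1 / fact m)"
proof -
  let ?P = "\<Pi>\<^sub>M i\<in>{1..m}. lborel :: real measure"
  let ?D = "simplex_chart_domain m"
  have D: "?D = {x. (\<forall>i\<in>{1..m}. 0 \<le> x i) \<and> sum x {1..m} \<le> 1} \<inter> space ?P"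
    by (auto simp: simplex_chart_domain_def)
  have top: "standard_simplex m \<in> sets (restrict_space borel (standard_simplex m))"
    by (metis Int_UNIV_right sets.top space_borel space_restrict_space)
  have vim: "simplex_chart m -` standard_simplex m \<inter> space (restrict_space ?P ?D) = ?D"
    using simplex_chart_in_simplex[of _ m]
    by (auto simp: space_restrict_space simplex_chart_domain_def)
  have "emeasure (simplex_measure m) (standard_simplex m) = emeasure (restrict_space ?P ?D) ?D"
    unfolding simplex_measure_def by (subst emeasure_distr[OF simplex_chart_measurable top]) (simp only: vim)
  also have "\<dots> = emeasure ?P ?D"
    using simplex_chart_domain_sets[of m]
    by (subst emeasure_restrict_space) auto
  also have "\<dots> = ennreal (1 ^ card {1..m} / fact (card {1..m}))"
    unfolding D using emeasure_std_simplex_aux[of "{1..m}" 1] by simp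
  finally show ?thesis by simp
qed

text \<open>
  Isabelle's \<open>0 powr 0 = 0\<close> affects the density below only on the faces \<open>z\<^sub>j = 0\<close>, which are
  null sets.
\<close>

definition multi_Beta :: "nat \<Rightarrow> (nat \<Rightarrow> real) \<Rightarrow> real" where
  "multi_Beta m \<alpha> = (\<Prod>j\<le>m. Gamma (\<alpha> j)) / Gamma (\<Sum>j\<le>m. \<alpha> j)"

definition dirichlet :: "nat \<Rightarrow> (nat \<Rightarrow> real) \<Rightarrow> (nat \<Rightarrow> real) measure" where
  "dirichlet m \<alpha> =
     density (simplex_measure m)
       (\<lambda>z. ennreal (1 / multi_Beta m \<alpha> * (\<Prod>j\<le>m. z j powr (\<alpha> j - 1))))"

text \<open>
  The multinomial distribution is the law of the vector of counts in \<open>l\<close> independent draws, each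
  yielding \<open>j\<close> with probability \<open>y\<^sub>j\<close>. It is only used for \<open>y\<close> in a standard simplex, so that
  \<open>y\<close> is a probability mass function on \<open>nat\<close>.
\<close>

definition multinomial_pmf :: "nat \<Rightarrow> (nat \<Rightarrow> real) \<Rightarrow> (nat \<Rightarrow> nat) pmf" where
  "multinomial_pmf l y = map_pmf (\<lambda>xs j. count_list xs j) (replicate_pmf l (embed_pmf y))"

definition Y_hat :: "nat \<Rightarrow> (nat \<Rightarrow> real) measure \<Rightarrow> nat \<Rightarrow> (nat \<Rightarrow> real) measure" where
  "Y_hat m Y l =
     Y \<bind> (\<lambda>y. measure_pmf (multinomial_pmf l y) \<bind> (\<lambda>\<alpha>. dirichlet m (\<lambda>j. real (\<alpha> j) + 1)))"


section \<open>Polynomial densities on the simplex\<close>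

text \<open>
  A polynomial in \<open>z\<^sub>0, z\<^sub>1, \<dots>\<close> maps exponent vectors to coefficients. Elements of
  \<open>\<real>[z\<^sub>0,\<dots>,z\<^sub>m]/(z\<^sub>0 + \<dots> + z\<^sub>m - 1)\<close> are represented by the polynomial functions they induce
  on the simplex, taken as undefined elsewhere.
\<close>

type_synonym real_mpoly = "(nat \<Rightarrow>\<^sub>0 nat) \<Rightarrow>\<^sub>0 real"

definition eval_mpoly :: "real_mpoly \<Rightarrow> (nat \<Rightarrow> real) \<Rightarrow> real" where
  "eval_mpoly p z =
     (\<Sum>a\<in>Poly_Mapping.keys p. Poly_Mapping.lookup p a *
        (\<Prod>j\<in>Poly_Mapping.keys a. z j ^ Poly_Mapping.lookup a j))"

definition mpolys :: "nat \<Rightarrow> real_mpoly set" where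
  "mpolys m = {p. \<forall>a\<in>Poly_Mapping.keys p. Poly_Mapping.keys a \<subseteq> {..m}}"

definition R_alg :: "nat \<Rightarrow> ((nat \<Rightarrow> real) \<Rightarrow> real) set" where
  "R_alg m = (\<lambda>p. restrict (eval_mpoly p) (standard_simplex m)) ` mpolys m"

definition R_plus :: "nat \<Rightarrow> ((nat \<Rightarrow> real) \<Rightarrow> real) set" where
  "R_plus m =
     {f \<in> R_alg m.
        (\<exists>p\<in>mpolys m. (\<forall>a. 0 \<le> Poly_Mapping.lookup p a) \<and>
           f = restrict (eval_mpoly p) (standard_simplex m)) \<and>
        (\<integral>z. f z \<partial>simplex_measure m) = 1}"

definition R_plus_distributions :: "nat \<Rightarrow> (nat \<Rightarrow> real) measure set" where
  "R_plus_distributions m = (\<lambda>f. density (simplex_measure m) (\<lambda>z. ennreal (f z))) ` R_plus m"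


section \<open>Simplicial mixture models\<close>

text \<open>
  A combinatorial \<open>k\<close>-simplex \<open>S = (i\<^sub>0 \<le> \<dots> \<le> i\<^sub>k)\<close> is a multiset; \<open>i\<^sub>j\<close> is entry \<open>j\<close> of its
  sorted list. Points of \<open>\<real>\<^bsup>M\<^esup>\<close> are functions on \<open>nat\<close> vanishing outside \<open>{1..M}\<close>, and an
  \<open>n \<times> M\<close> matrix is given by its columns \<open>V 1, \<dots>, V M\<close>.
\<close>

definition comb_simplices :: "nat \<Rightarrow> nat \<Rightarrow> nat multiset set" where
  "comb_simplices k M = multisets_of_size {1..M} (k + 1)"

definition simplex_map :: "nat \<Rightarrow> nat multiset \<Rightarrow> (nat \<Rightarrow> real) \<Rightarrow> (nat \<Rightarrow> real)" where
  "simplex_map k S z =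
     (\<lambda>i. \<Sum>j\<le>k. z j * (if i = sorted_list_of_multiset S ! j then 1 else 0))"

definition U_simplex :: "nat \<Rightarrow> nat multiset \<Rightarrow> (nat \<Rightarrow> real) measure" where
  "U_simplex k S =
     distr (uniform_measure (simplex_measure k) (standard_simplex k)) borel (simplex_map k S)"

definition mat_apply :: "nat \<Rightarrow> (nat \<Rightarrow> real^'n) \<Rightarrow> (nat \<Rightarrow> real) \<Rightarrow> real^'n" where
  "mat_apply M V u = (\<Sum>i=1..M. u i *\<^sub>R V i)"

definition simplicial_mixture ::
    "nat \<Rightarrow> nat \<Rightarrow> nat multiset pmf \<Rightarrow> (nat \<Rightarrow> real^'n) \<Rightarrow> (real^'n) measure" where
  "simplicial_mixture k M p V =
     distr (measure_pmf p \<bind> U_simplex k) borel (mat_apply M V)"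

definition simplicial_mixture_models :: "nat \<Rightarrow> (real^'n) measure set" where
  "simplicial_mixture_models M =
     {simplicial_mixture k M p V | k p V. set_pmf p \<subseteq> comb_simplices k M}"

end

theory Submission
  imports Defs
begin

text \<open>
  Both parts rest on a Bernstein-type argument: given \<open>y\<close>, the vector \<open>\<alpha>\<close> counts the letters of a random
  word with independent letters distributed as \<open>y\<close>, and the point drawn afterwards has conditional
  mean close to \<open>\<alpha>/l\<close> and small variance. Its mean square distance to \<open>y\<close> is \<open>O(1/l)\<close> uniformly
  in \<open>y\<close>, so expectations of continuous functions converge. Expanding over words turns \<open>Y_hat\<close> into a
  density that is a polynomial with non-negative coefficients.

  For part (2), write the support of \<open>X\<close> in barycentric coordinates of a large simplex. A word
  of length \<open>k + 1\<close> over the vertices is itself a combinatorial \<open>k\<close>-simplex, and the first two moments of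
  \<open>U\<^sub>S\<close> suffice for the same concentration argument; it is not necessary to identify \<open>U\<^sub>S\<close> as a Dirichlet
  distribution.
\<close>

section \<open>Monomial integrals over the simplex\<close>

text \<open>Concentration enters through one test function, the squared distance: on the compact
  simplex every continuous f satisfies |f x - f y| <= eps + C |x - y|^2, so two moments decide
  everything and no tail probability is estimated.

  In both models the point drawn for a word with letter counts c_j has, formally, the first two
  moments of a Dirichlet vector with parameters c_j + s and total l + r. For \<open>Y_hat\<close>
  these are s = 1, r = m + 1; for \<open>U_simplex\<close> they are s = r = 0 with l = k + 1,
  because each coordinate adds up c_j coordinates of a uniform point. Hence a single convergence
  lemma with parameters s and r serves both parts.

  Words are preferred to count vectors because the probability of a word is a plain product: moments
  follow by induction on the first letter, without multinomial coefficients.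

  On the Dirichlet side the obstacle is the boundary: \<open>powr\<close> and natural powers
  disagree on the faces, so these have to be shown null before a density can be treated as a
  polynomial.\<close>

lemma nn_integral_power_convolution:
  fixes h g :: "real \<Rightarrow> ennreal"
  assumes "\<And>x. x < 0 \<Longrightarrow> h x = 0" "\<And>x. 0 < x \<Longrightarrow> h x = ennreal (x ^ a / fact a)"
    and "\<And>x. x < 0 \<Longrightarrow> g x = 0" "\<And>x. 0 < x \<Longrightarrow> g x = ennreal (x ^ b / fact b)"
    and "s \<noteq> 0"
  shows "(\<integral>\<^sup>+t. h t * g (s - t) \<partial>lborel) =
    (if s < 0 then 0 else ennreal (s ^ (a + b + 1) / fact (a + b + 1)))"
proof -
  \<comment> \<open>Erlang densities of rate 1 are the truncated powers x^k / k! times exp(-x).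
    Since exp(-t) exp(-(s - t)) = exp(-s) does not depend on t, the factor \<open>exp s\<close>
    reduces the claim to the known convolution of Erlang densities.\<close>
  let ?e = "\<lambda>k x. ennreal (erlang_density k 1 x)"
  have "(\<integral>\<^sup>+t. h t * g (s - t) \<partial>lborel) = (\<integral>\<^sup>+t. ennreal (exp s) * (?e b (s - t) * ?e a t) \<partial>lborel)"
  proof (rule nn_integral_cong_AE)
    have "AE t in lborel. t \<noteq> 0" "AE t in lborel. t \<noteq> s"
      by (rule AE_lborel_singleton)+
    then show "AE t in lborel. h t * g (s - t) = ennreal (exp s) * (?e b (s - t) * ?e a t)"
    proof eventually_elim
      fix t assume t: "t \<noteq> 0" "t \<noteq> s"
      show "h t * g (s - t) = ennreal (exp s) * (?e b (s - t) * ?e a t)"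
      proof (cases "0 < t \<and> t < s")
        case True
        have "t ^ a / fact a * ((s - t) ^ b / fact b) =
            exp s * (((s - t) ^ b * exp (- (s - t))) / fact b * (t ^ a * exp (- t) / fact a))"
          by (simp add: exp_minus exp_diff field_simps)
        with True assms show ?thesis
          by (simp add: erlang_density_def ennreal_mult[symmetric])
      next
        case False
        then have "t < 0 \<or> s - t < 0" using t by auto
        then show ?thesis using assms by (auto simp: erlang_density_def)
      qed
    qed
  qed
  also have "\<dots> = ennreal (exp s) * (\<integral>\<^sup>+t. ?e b (s - t) * ?e a t \<partial>lborel)"
    by (rule nn_integral_cmult) measurable
  also have "(\<integral>\<^sup>+t. ?e b (s - t) * ?e a t \<partial>lborel) = ?e (Suc b + Suc a - 1) s"
    using fun_cong[OF convolution_erlang_density[of 1 b a], of s] by simp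
  also have "ennreal (exp s) * \<dots> =
      (if s < 0 then 0 else ennreal (s ^ (a + b + 1) / fact (a + b + 1)))"
    by (auto simp: erlang_density_def ennreal_mult[symmetric] exp_minus add.commute)
  finally show ?thesis .
qed

text \<open>Integrating out coordinate j is one convolution and raises the exponent by
  \<open>a j + 1\<close>; the ones add up to \<open>card A\<close>. The value \<open>g 0\<close> is
  left open, so s = 0 is excluded, and in the induction the exceptional point y = s is a null
  set.\<close>

lemma nn_integral_PiM_power_convolution:
  fixes h :: "'i \<Rightarrow> real \<Rightarrow> ennreal" and g :: "real \<Rightarrow> ennreal"
  assumes "finite A"
    and [measurable]: "\<And>i. h i \<in> borel_measurable borel" "g \<in> borel_measurable borel"
    and h0: "\<And>i x. x < 0 \<Longrightarrow> h i x = 0"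
    and h1: "\<And>i x. 0 < x \<Longrightarrow> h i x = ennreal (x ^ a i / fact (a i))"
    and g0: "\<And>x. x < 0 \<Longrightarrow> g x = 0"
    and g1: "\<And>x. 0 < x \<Longrightarrow> g x = ennreal (x ^ b / fact b)"
    and "s \<noteq> 0"
  shows "(\<integral>\<^sup>+x. (\<Prod>i\<in>A. h i (x i)) * g (s - (\<Sum>i\<in>A. x i)) \<partial>(\<Pi>\<^sub>M i\<in>A. lborel)) =
    (if s < 0 then 0 else
      ennreal (s ^ (card A + (\<Sum>i\<in>A. a i) + b) / fact (card A + (\<Sum>i\<in>A. a i) + b)))"
  using assms(1) \<open>s \<noteq> 0\<close>
proof (induction A arbitrary: s rule: finite_induct)
  case empty
  then show ?case by (auto simp: PiM_empty nn_integral_count_space_finite g0 g1)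
next
  case (insert j A)
  interpret product_sigma_finite "\<lambda>_::'i. lborel :: real measure" ..
  let ?n = "card A + (\<Sum>i\<in>A. a i) + b"
  let ?E = "\<lambda>s::real. if s < 0 then 0 else ennreal (s ^ ?n / fact ?n)"
  have "(\<integral>\<^sup>+x. (\<Prod>i\<in>insert j A. h i (x i)) * g (s - (\<Sum>i\<in>insert j A. x i)) \<partial>(\<Pi>\<^sub>M i\<in>insert j A. lborel)) =
    (\<integral>\<^sup>+y. \<integral>\<^sup>+x. (\<Prod>i\<in>insert j A. h i ((x(j := y)) i)) * g (s - (\<Sum>i\<in>insert j A. (x(j := y)) i))
       \<partial>(\<Pi>\<^sub>M i\<in>A. lborel) \<partial>lborel)"
    using insert by (subst product_nn_integral_insert_rev) simp_all
  also have "\<dots> = (\<integral>\<^sup>+y. \<integral>\<^sup>+x. h j y * ((\<Prod>i\<in>A. h i (x i)) * g (s - y - (\<Sum>i\<in>A. x i)))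
       \<partial>(\<Pi>\<^sub>M i\<in>A. lborel) \<partial>lborel)"
  proof (intro nn_integral_cong)
    fix y :: real and x
    have "(\<Prod>i\<in>A. h i ((x(j := y)) i)) = (\<Prod>i\<in>A. h i (x i))"
        "(\<Sum>i\<in>A. (x(j := y)) i) = (\<Sum>i\<in>A. x i)"
      using insert.hyps by (auto intro!: prod.cong sum.cong)
    then show "(\<Prod>i\<in>insert j A. h i ((x(j := y)) i)) * g (s - (\<Sum>i\<in>insert j A. (x(j := y)) i)) =
        h j y * ((\<Prod>i\<in>A. h i (x i)) * g (s - y - (\<Sum>i\<in>A. x i)))"
      using insert.hyps by (simp add: algebra_simps)
  qed
  also have "\<dots> = (\<integral>\<^sup>+y. h j y * (\<integral>\<^sup>+x. (\<Prod>i\<in>A. h i (x i)) * g (s - y - (\<Sum>i\<in>A. x i))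
       \<partial>(\<Pi>\<^sub>M i\<in>A. lborel)) \<partial>lborel)"
    by (intro nn_integral_cong nn_integral_cmult) measurable
  also have "\<dots> = (\<integral>\<^sup>+y. h j y * ?E (s - y) \<partial>lborel)"
  proof (rule nn_integral_cong_AE)
    show "AE y in lborel. h j y * (\<integral>\<^sup>+x. (\<Prod>i\<in>A. h i (x i)) * g (s - y - (\<Sum>i\<in>A. x i))
       \<partial>(\<Pi>\<^sub>M i\<in>A. lborel)) = h j y * ?E (s - y)"
      using AE_lborel_singleton[of s]
    proof eventually_elim
      fix y assume "y \<noteq> s"
      then show "h j y * (\<integral>\<^sup>+x. (\<Prod>i\<in>A. h i (x i)) * g (s - y - (\<Sum>i\<in>A. x i))
       \<partial>(\<Pi>\<^sub>M i\<in>A. lborel)) = h j y * ?E (s - y)"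
        by (subst insert.IH) auto
    qed
  qed
  also have "\<dots> = (if s < 0 then 0 else ennreal (s ^ (a j + ?n + 1) / fact (a j + ?n + 1)))"
    using insert.prems by (intro nn_integral_power_convolution) (auto simp: h0 h1)
  also have "a j + ?n + 1 = card (insert j A) + (\<Sum>i\<in>insert j A. a i) + b"
    using insert.hyps by simp
  finally show ?case .
qed

lemma sets_simplex_measure [simp, measurable_cong]:
  "sets (simplex_measure m) = sets (restrict_space borel (standard_simplex m))"
  by (simp add: simplex_measure_def)

lemma space_simplex_measure [simp]: "space (simplex_measure m) = standard_simplex m"
  by (simp add: simplex_measure_def space_restrict_space)

lemma measurable_component_borel [measurable]: "(\<lambda>z::'i \<Rightarrow> real. z j) \<in> borel_measurable borel"
  by (rule measurable_product_then_coordinatewise) simp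

lemma measurable_component_simplex [measurable]:
  "(\<lambda>z. z j) \<in> borel_measurable (restrict_space borel (standard_simplex m))"
  by (rule measurable_restrict_space1) measurable

text \<open>
  Only the values of \<open>h\<close> at positive arguments matter, since the faces of the simplex are null
  sets; leaving \<open>h j 0\<close> free lets the lemma also prove that they are.
\<close>

lemma nn_integral_simplex_monomial:
  fixes h :: "nat \<Rightarrow> real \<Rightarrow> ennreal"
  assumes [measurable]: "\<And>j. h j \<in> borel_measurable borel"
    and h1: "\<And>j x. 0 < x \<Longrightarrow> h j x = ennreal (x ^ a j / fact (a j))"
  shows "(\<integral>\<^sup>+z. (\<Prod>j\<le>m. h j (z j)) \<partial>simplex_measure m) = ennreal (1 / fact (m + (\<Sum>j\<le>m. a j)))"
proof -
  let ?P = "\<Pi>\<^sub>M i\<in>{1..m}. lborel :: real measure"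
  let ?D = "simplex_chart_domain m"
  \<comment> \<open>A point lies outside the chart domain exactly when some coordinate or 1 minus
    their sum is negative. Truncating the factors at 0 therefore absorbs the indicator of the
    domain, and the integral becomes the iterated convolution at s = 1, with coordinate 0 in the
    role of g.\<close>
  let ?h = "\<lambda>j x. if x < 0 then 0 else h j x"
  have ins: "{..m} = insert 0 {1..m}" by auto
  have "(\<integral>\<^sup>+z. (\<Prod>j\<le>m. h j (z j)) \<partial>simplex_measure m) =
      (\<integral>\<^sup>+x. (\<Prod>j\<le>m. h j (simplex_chart m x j)) \<partial>restrict_space ?P ?D)"
    unfolding simplex_measure_def by (rule nn_integral_distr[OF simplex_chart_measurable]) measurable
  also have "\<dots> = (\<integral>\<^sup>+x. (\<Prod>j\<le>m. h j (simplex_chart m x j)) * indicator ?D x \<partial>?P)"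
    using simplex_chart_domain_sets[of m]
    by (subst nn_integral_restrict_space) auto
  also have "\<dots> = (\<integral>\<^sup>+x. (\<Prod>i\<in>{1..m}. ?h i (x i)) * ?h 0 (1 - (\<Sum>i\<in>{1..m}. x i)) \<partial>?P)"
  proof (rule nn_integral_cong)
    fix x assume x: "x \<in> space ?P"
    have eq: "(\<Prod>j\<le>m. h j (simplex_chart m x j)) =
        h 0 (1 - (\<Sum>i\<in>{1..m}. x i)) * (\<Prod>i\<in>{1..m}. h i (x i))"
      unfolding ins by (simp add: simplex_chart_def)
    show "(\<Prod>j\<le>m. h j (simplex_chart m x j)) * indicator ?D x =
        (\<Prod>i\<in>{1..m}. ?h i (x i)) * ?h 0 (1 - (\<Sum>i\<in>{1..m}. x i))"
    proof (cases "x \<in> ?D")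
      case True
      then have "(\<Prod>i\<in>{1..m}. ?h i (x i)) = (\<Prod>i\<in>{1..m}. h i (x i))"
        by (intro prod.cong) (auto simp: simplex_chart_domain_def dest: bspec)
      moreover have "\<not> 1 - (\<Sum>i\<in>{1..m}. x i) < 0"
        using True by (auto simp: simplex_chart_domain_def)
      ultimately show ?thesis using True eq by (simp add: mult.commute)
    next
      case False
      then have "(\<exists>i\<in>{1..m}. x i < 0) \<or> 1 - (\<Sum>i\<in>{1..m}. x i) < 0"
        using x by (auto simp: simplex_chart_domain_def not_le)
      then have "(\<Prod>i\<in>{1..m}. ?h i (x i)) * ?h 0 (1 - (\<Sum>i\<in>{1..m}. x i)) = 0"
      proof
        assume "\<exists>i\<in>{1..m}. x i < 0"
        then have "(\<Prod>i\<in>{1..m}. ?h i (x i)) = 0"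
          by (intro prod_zero) auto
        then show ?thesis by simp
      qed simp
      then show ?thesis using False by simp
    qed
  qed
  also have "\<dots> = (if (1::real) < 0 then 0 else
      ennreal (1 ^ (card {1..m} + (\<Sum>i\<in>{1..m}. a i) + a 0) /
        fact (card {1..m} + (\<Sum>i\<in>{1..m}. a i) + a 0)))"
    by (rule nn_integral_PiM_power_convolution) (auto simp: h1)
  also have "\<dots> = ennreal (1 / fact (m + (\<Sum>j\<le>m. a j)))"
    by (simp add: ins add_ac)
  finally show ?thesis .
qed

text \<open>With all exponents 0 and h equal to 1 except at 0, the monomial formula says that the
  part off the faces already has the full volume 1/m!.\<close>

lemma AE_simplex_measure_pos: "AE z in simplex_measure m. \<forall>j\<le>m. 0 < z j"
proof -
  let ?S = "simplex_measure m"
  let ?N = "{z \<in> space ?S. \<exists>j\<le>m. z j = 0}"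
  have N: "?N \<in> sets ?S"
    by measurable
  have "emeasure ?S (space ?S - ?N) = (\<integral>\<^sup>+z. indicator (space ?S - ?N) z \<partial>?S)"
    by (rule nn_integral_indicator[symmetric]) (intro sets.compl_sets N)
  also have "\<dots> = (\<integral>\<^sup>+z. (\<Prod>j\<le>m. indicator (- {0::real}) (z j)) \<partial>?S)"
  proof (rule nn_integral_cong)
    fix z assume z: "z \<in> space ?S"
    show "indicator (space ?S - ?N) z = (\<Prod>j\<le>m. indicator (- {0::real}) (z j) :: ennreal)"
    proof (cases "\<exists>j\<le>m. z j = 0")
      case True
      then have "(\<Prod>j\<le>m. indicator (- {0::real}) (z j) :: ennreal) = 0"
        by (auto simp: indicator_def)
      then show ?thesis using True z by (auto simp: indicator_def)
    next
      case False
      then have "(\<Prod>j\<le>m. indicator (- {0::real}) (z j) :: ennreal) = 1"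
        by (intro prod.neutral) (auto simp: indicator_def)
      then show ?thesis using False z by (auto simp: indicator_def)
    qed
  qed
  also have "\<dots> = ennreal (1 / fact (m + (\<Sum>j\<le>m. 0)))"
    by (rule nn_integral_simplex_monomial) (auto simp: indicator_def)
  finally have c: "emeasure ?S (space ?S - ?N) = ennreal (1 / fact m)" by simp
  have "emeasure ?S ?N = emeasure ?S (space ?S - (space ?S - ?N))"
    by (rule arg_cong[where f="emeasure ?S"]) auto
  also have "\<dots> = emeasure ?S (space ?S) - emeasure ?S (space ?S - ?N)"
    by (rule emeasure_compl[OF sets.compl_sets[OF N]]) (unfold c, simp)
  also have "\<dots> = 0" unfolding c by (simp add: emeasure_simplex_measure)
  finally have "emeasure ?S ?N = 0" .
  then have "AE z in ?S. z \<notin> ?N"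
    by (intro AE_not_in null_setsI N)
  then show ?thesis
    using AE_space
  proof eventually_elim
    fix z assume "z \<notin> ?N" "z \<in> space ?S"
    then show "\<forall>j\<le>m. 0 < z j"
      by (auto simp: standard_simplex_def order.strict_iff_order)
  qed
qed

section \<open>Moments of Dirichlet distributions\<close>

lemma nonneg_standard_simplex: "z \<in> standard_simplex m \<Longrightarrow> 0 \<le> z j"
  by (simp add: standard_simplex_def)

lemma has_bochner_integral_simplex_monomial:
  "has_bochner_integral (simplex_measure m) (\<lambda>z. \<Prod>j\<le>m. z j ^ a j)
     ((\<Prod>j\<le>m. fact (a j)) / fact (m + (\<Sum>j\<le>m. a j)))"
proof (rule has_bochner_integral_nn_integral)
  have "(\<integral>\<^sup>+z. ennreal (\<Prod>j\<le>m. z j ^ a j) \<partial>simplex_measure m) =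
      (\<integral>\<^sup>+z. ennreal (\<Prod>j\<le>m. fact (a j)) * (\<Prod>j\<le>m. ennreal (z j ^ a j / fact (a j))) \<partial>simplex_measure m)"
    by (intro nn_integral_cong)
      (auto simp: prod_ennreal nonneg_standard_simplex ennreal_mult[symmetric] prod_nonneg
         prod.distrib[symmetric] simp del: of_nat_fact)
  also have "\<dots> = ennreal (\<Prod>j\<le>m. fact (a j)) *
      (\<integral>\<^sup>+z. (\<Prod>j\<le>m. ennreal (z j ^ a j / fact (a j))) \<partial>simplex_measure m)"
    by (rule nn_integral_cmult) measurable
  also have "\<dots> = ennreal (\<Prod>j\<le>m. fact (a j)) * ennreal (1 / fact (m + (\<Sum>j\<le>m. a j)))"
    by (subst nn_integral_simplex_monomial[where a=a and h="\<lambda>j x. ennreal (x ^ a j / fact (a j))"]) auto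
  finally show "(\<integral>\<^sup>+z. ennreal (\<Prod>j\<le>m. z j ^ a j) \<partial>simplex_measure m) =
      ennreal ((\<Prod>j\<le>m. fact (a j)) / fact (m + (\<Sum>j\<le>m. a j)))"
    by (simp add: ennreal_mult[symmetric] prod_nonneg)
qed (auto intro!: AE_I2 prod_nonneg divide_nonneg_nonneg simp: nonneg_standard_simplex)

text \<open>Natural powers in place of \<open>powr\<close> make this a polynomial on the whole
  simplex, faces included, as membership in \<open>R_plus\<close> demands.\<close>

definition dirichlet_density :: "nat \<Rightarrow> (nat \<Rightarrow> nat) \<Rightarrow> (nat \<Rightarrow> real) \<Rightarrow> real" where
  "dirichlet_density m \<alpha> z =
     fact (m + (\<Sum>j\<le>m. \<alpha> j)) / (\<Prod>j\<le>m. fact (\<alpha> j)) * (\<Prod>j\<le>m. z j ^ \<alpha> j)"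

lemma dirichlet_density_nonneg: "z \<in> standard_simplex m \<Longrightarrow> 0 \<le> dirichlet_density m \<alpha> z"
  unfolding dirichlet_density_def
  by (intro mult_nonneg_nonneg divide_nonneg_nonneg prod_nonneg) (auto simp: nonneg_standard_simplex)

lemma measurable_dirichlet_density [measurable]:
  "dirichlet_density m \<alpha> \<in> borel_measurable (restrict_space borel (standard_simplex m))"
  unfolding dirichlet_density_def[abs_def] by measurable

lemma multi_Beta_nat:
  "multi_Beta m (\<lambda>j. real (\<alpha> j) + 1) = (\<Prod>j\<le>m. fact (\<alpha> j)) / fact (m + (\<Sum>j\<le>m. \<alpha> j))"
proof -
  have "(\<Sum>j\<le>m. real (\<alpha> j) + 1) = 1 + real (m + (\<Sum>j\<le>m. \<alpha> j))"
    by (simp add: sum.distrib)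
  then show ?thesis
    unfolding multi_Beta_def by (simp add: Gamma_fact add.commute[of _ 1] del: of_nat_add of_nat_sum)
qed

text \<open>The two densities agree only almost everywhere: at a zero coordinate with exponent 0,
  \<open>powr\<close> gives 0 and the natural power gives 1.\<close>

lemma dirichlet_nat:
  "dirichlet m (\<lambda>j. real (\<alpha> j) + 1) = density (simplex_measure m) (\<lambda>z. ennreal (dirichlet_density m \<alpha> z))"
  unfolding dirichlet_def
proof (rule density_cong)
  show "AE z in simplex_measure m.
      ennreal (1 / multi_Beta m (\<lambda>j. real (\<alpha> j) + 1) * (\<Prod>j\<le>m. z j powr (real (\<alpha> j) + 1 - 1))) =
      ennreal (dirichlet_density m \<alpha> z)"
    using AE_simplex_measure_pos
    by eventually_elim (simp add: dirichlet_density_def multi_Beta_nat powr_realpow)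
qed measurable

lemma sets_dirichlet [simp, measurable_cong]:
  "sets (dirichlet m \<alpha>) = sets (restrict_space borel (standard_simplex m))"
  by (simp add: dirichlet_def)

lemma space_dirichlet [simp]: "space (dirichlet m \<alpha>) = standard_simplex m"
  by (simp add: dirichlet_def)

text \<open>Density times monomial is again a monomial, so a mixed moment is a ratio of two simplex
  integrals.\<close>

lemma has_bochner_integral_dirichlet_monomial:
  "has_bochner_integral (dirichlet m (\<lambda>j. real (\<alpha> j) + 1)) (\<lambda>z. \<Prod>j\<le>m. z j ^ b j)
     ((\<Prod>j\<le>m. fact (\<alpha> j + b j) / fact (\<alpha> j)) *
       fact (m + (\<Sum>j\<le>m. \<alpha> j)) / fact (m + (\<Sum>j\<le>m. \<alpha> j) + (\<Sum>j\<le>m. b j)))"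
  unfolding dirichlet_nat
proof (rule has_bochner_integral_density)
  have "has_bochner_integral (simplex_measure m)
     (\<lambda>z. fact (m + (\<Sum>j\<le>m. \<alpha> j)) / (\<Prod>j\<le>m. fact (\<alpha> j)) * (\<Prod>j\<le>m. z j ^ (\<alpha> j + b j)))
     (fact (m + (\<Sum>j\<le>m. \<alpha> j)) / (\<Prod>j\<le>m. fact (\<alpha> j)) *
       ((\<Prod>j\<le>m. fact (\<alpha> j + b j)) / fact (m + (\<Sum>j\<le>m. \<alpha> j + b j))))"
    by (intro has_bochner_integral_mult_right has_bochner_integral_simplex_monomial)
  then show "has_bochner_integral (simplex_measure m)
     (\<lambda>z. dirichlet_density m \<alpha> z *\<^sub>R (\<Prod>j\<le>m. z j ^ b j))
     ((\<Prod>j\<le>m. fact (\<alpha> j + b j) / fact (\<alpha> j)) *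
       fact (m + (\<Sum>j\<le>m. \<alpha> j)) / fact (m + (\<Sum>j\<le>m. \<alpha> j) + (\<Sum>j\<le>m. b j)))"
    by (simp add: dirichlet_density_def power_add prod.distrib sum.distrib prod_dividef
        add.assoc mult_ac)
qed (auto simp: dirichlet_density_nonneg)

lemma prob_space_dirichlet: "prob_space (dirichlet m (\<lambda>j. real (\<alpha> j) + 1))" (is "prob_space ?D")
proof
  have *: "has_bochner_integral ?D (\<lambda>_. 1) (1::real)"
    using has_bochner_integral_dirichlet_monomial[of m \<alpha> "\<lambda>_. 0"] by simp
  then have "(\<integral>\<^sup>+x. ennreal 1 \<partial>?D) = ennreal 1"
    by (subst nn_integral_eq_integral) (auto dest: has_bochner_integral_integral_eq integrable.intros)
  then show "emeasure ?D (space ?D) = 1" by simp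
qed

text \<open>With exponent r at coordinate i only, the factorial quotients collapse to rising
  factorials: \<alpha>_i + 1, ..., \<alpha>_i + r above and n + m + 1, ..., n + m + r below, where n
  is the sum of the \<alpha>_j.\<close>

lemma
  assumes "i \<le> m"
  shows has_bochner_integral_dirichlet_fst:
      "has_bochner_integral (dirichlet m (\<lambda>j. real (\<alpha> j) + 1)) (\<lambda>z. z i)
        ((real (\<alpha> i) + 1) / (real (\<Sum>j\<le>m. \<alpha> j) + real (m + 1)))"
    and has_bochner_integral_dirichlet_snd:
      "has_bochner_integral (dirichlet m (\<lambda>j. real (\<alpha> j) + 1)) (\<lambda>z. (z i)\<^sup>2)
        ((real (\<alpha> i) + 1) * (real (\<alpha> i) + 2) /
          ((real (\<Sum>j\<le>m. \<alpha> j) + real (m + 1)) * (real (\<Sum>j\<le>m. \<alpha> j) + real (m + 1) + 1)))"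
proof -
  let ?d = "\<lambda>r j. if j = i then r else (0::nat)"
  have pw: "(\<Prod>j\<le>m. z j ^ ?d r j) = z i ^ r" for z :: "nat \<Rightarrow> real" and r
  proof -
    have "(\<Prod>j\<le>m. z j ^ ?d r j) = (\<Prod>j\<le>m. if j = i then z j ^ r else 1)"
      by (rule prod.cong) auto
    with assms show ?thesis by simp
  qed
  have f: "(\<Prod>j\<le>m. fact (\<alpha> j + ?d r j) / fact (\<alpha> j)) = (fact (\<alpha> i + r) / fact (\<alpha> i) :: real)" for r
  proof -
    have "(\<Prod>j\<le>m. fact (\<alpha> j + ?d r j) / fact (\<alpha> j) :: real) =
        (\<Prod>j\<le>m. if j = i then fact (\<alpha> j + r) / fact (\<alpha> j) else 1)"
      by (rule prod.cong) auto
    with assms show ?thesis by simp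
  qed
  have s: "(\<Sum>j\<le>m. ?d r j) = r" for r using assms by simp
  let ?n = "\<Sum>j\<le>m. \<alpha> j"
  have "fact (\<alpha> i + 1) / fact (\<alpha> i) = real (\<alpha> i) + 1"
    by (simp add: field_simps)
  moreover have "fact (m + ?n) / fact (m + ?n + 1) = 1 / (real ?n + real (m + 1))"
    by (simp add: divide_simps del: of_nat_sum)
  ultimately show "has_bochner_integral (dirichlet m (\<lambda>j. real (\<alpha> j) + 1)) (\<lambda>z. z i)
        ((real (\<alpha> i) + 1) / (real ?n + real (m + 1)))"
    using has_bochner_integral_dirichlet_monomial[of m \<alpha> "?d 1"]
    unfolding pw f s times_divide_eq_right[symmetric] by (simp add: add_ac del: of_nat_sum)
  have "fact (\<alpha> i + 2) / fact (\<alpha> i) = (real (\<alpha> i) + 1) * (real (\<alpha> i) + 2)"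
    by (simp add: numeral_2_eq_2 field_simps)
  moreover have "fact (m + ?n) / fact (m + ?n + 2) =
      1 / ((real ?n + real (m + 1)) * (real ?n + real (m + 1) + 1))"
    by (simp add: numeral_2_eq_2 divide_simps del: of_nat_sum) (simp add: algebra_simps del: of_nat_sum)
  ultimately show "has_bochner_integral (dirichlet m (\<lambda>j. real (\<alpha> j) + 1)) (\<lambda>z. (z i)\<^sup>2)
      ((real (\<alpha> i) + 1) * (real (\<alpha> i) + 2) /
          ((real ?n + real (m + 1)) * (real ?n + real (m + 1) + 1)))"
    using has_bochner_integral_dirichlet_monomial[of m \<alpha> "?d 2"]
    unfolding pw f s times_divide_eq_right[symmetric] by (simp del: of_nat_sum)
qed

section \<open>Moments of the uniform distribution on the simplex\<close>

lemma uniform_simplex_eq_dirichlet: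
  "uniform_measure (simplex_measure m) (standard_simplex m) = dirichlet m (\<lambda>j. real 0 + 1)"
  unfolding dirichlet_nat uniform_measure_def
proof (rule density_cong)
  show "AE z in simplex_measure m. indicator (standard_simplex m) z /
      emeasure (simplex_measure m) (standard_simplex m) = ennreal (dirichlet_density m (\<lambda>j. 0) z)"
    by (rule AE_I2)
      (simp add: emeasure_simplex_measure dirichlet_density_def divide_ennreal flip: ennreal_1)
  have "standard_simplex m \<in> sets (simplex_measure m)"
    using sets.top[of "simplex_measure m"] by simp
  then show "(\<lambda>z. indicator (standard_simplex m) z / emeasure (simplex_measure m) (standard_simplex m))
      \<in> borel_measurable (simplex_measure m)"
    by measurable
qed measurable

text \<open>The diagonal value is twice the other one because the square of z_i contributes 2! where
  z_i z_j contributes 1! 1!.\<close>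

lemma has_bochner_integral_uniform_simplex_mult:
  assumes "i \<le> m" "j \<le> m"
  shows "has_bochner_integral (uniform_measure (simplex_measure m) (standard_simplex m)) (\<lambda>z. z i * z j)
    ((if i = j then 2 else 1) / ((real m + 1) * (real m + 2)))"
proof (cases "i = j")
  case True
  then show ?thesis
    using has_bochner_integral_dirichlet_snd[OF assms(1), of "\<lambda>_. 0"]
    unfolding uniform_simplex_eq_dirichlet by (simp add: power2_eq_square add_ac)
next
  case False
  let ?d = "\<lambda>k. (if k = i then 1 else 0) + (if k = j then 1 else (0::nat))"
  have "(\<Prod>k\<le>m. z k ^ ?d k) = z i * z j" for z :: "nat \<Rightarrow> real"
  proof -
    have "(\<Prod>k\<le>m. z k ^ ?d k) = (\<Prod>k\<le>m. (if k = i then z k else 1) * (if k = j then z k else 1))"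
      by (rule prod.cong) (auto simp: power_add)
    with assms show ?thesis by (simp add: prod.distrib)
  qed
  moreover have "(\<Prod>k\<le>m. fact (0 + ?d k) / fact 0) = (1::real)"
    using False by (intro prod.neutral) auto
  moreover have "(\<Sum>k\<le>m. ?d k) = 2" using assms by (simp add: sum.distrib)
  moreover have "fact m / fact (m + 2) = 1 / ((real m + 1) * (real m + 2))"
    by (simp add: numeral_2_eq_2 divide_simps) (simp add: algebra_simps)
  ultimately show ?thesis
    using has_bochner_integral_dirichlet_monomial[of m "\<lambda>_. 0" ?d] False
    unfolding uniform_simplex_eq_dirichlet by simp
qed

lemma has_bochner_integral_uniform_simplex_single:
  assumes "i \<le> m"
  shows "has_bochner_integral (uniform_measure (simplex_measure m) (standard_simplex m)) (\<lambda>z. z i)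
    (1 / (real m + 1))"
  using has_bochner_integral_dirichlet_fst[OF assms, of "\<lambda>_. 0"]
  unfolding uniform_simplex_eq_dirichlet by (simp add: add_ac)

text \<open>When J is the set of positions carrying a given vertex, the sum over J is the
  corresponding coordinate of \<open>U_simplex\<close>. The second moment has c^2 pairs, of which
  the c diagonal ones count twice, which gives c (c + 1).\<close>

lemma
  assumes "J \<subseteq> {..m}"
  shows has_bochner_integral_uniform_simplex_sum_fst:
      "has_bochner_integral (uniform_measure (simplex_measure m) (standard_simplex m)) (\<lambda>z. \<Sum>j\<in>J. z j)
        (real (card J) / (real m + 1))"
    and has_bochner_integral_uniform_simplex_sum_snd:
      "has_bochner_integral (uniform_measure (simplex_measure m) (standard_simplex m)) (\<lambda>z. (\<Sum>j\<in>J. z j)\<^sup>2)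
        (real (card J) * (real (card J) + 1) / ((real m + 1) * (real m + 2)))"
proof -
  let ?U = "uniform_measure (simplex_measure m) (standard_simplex m)"
  have fin: "finite J" using assms finite_subset by blast
  have "has_bochner_integral ?U (\<lambda>z. \<Sum>j\<in>J. z j) (\<Sum>j\<in>J. 1 / (real m + 1))"
    by (intro has_bochner_integral_sum has_bochner_integral_uniform_simplex_single) (use assms in auto)
  then show "has_bochner_integral ?U (\<lambda>z. \<Sum>j\<in>J. z j) (real (card J) / (real m + 1))"
    by simp
  have "has_bochner_integral ?U (\<lambda>z. \<Sum>i\<in>J. \<Sum>j\<in>J. z i * z j)
      (\<Sum>i\<in>J. \<Sum>j\<in>J. (if i = j then 2 else 1) / ((real m + 1) * (real m + 2)))"
    by (intro has_bochner_integral_sum has_bochner_integral_uniform_simplex_mult) (use assms in auto)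
  moreover have "(\<Sum>i\<in>J. \<Sum>j\<in>J. (if i = j then 2 else 1) / ((real m + 1) * (real m + 2))) =
      real (card J) * (real (card J) + 1) / ((real m + 1) * (real m + 2))"
  proof -
    have "(\<Sum>j\<in>J. if i = j then 2 else 1) = real (card J) + 1" if "i \<in> J" for i
    proof -
      have "(\<Sum>j\<in>J. if i = j then 2 else 1) = (\<Sum>j\<in>J. 1 + (if i = j then 1 else (0::real)))"
        by (rule sum.cong) auto
      then show ?thesis using fin that by (simp add: sum.distrib)
    qed
    then show ?thesis by (simp add: sum_divide_distrib[symmetric])
  qed
  ultimately show "has_bochner_integral ?U (\<lambda>z. (\<Sum>j\<in>J. z j)\<^sup>2)
        (real (card J) * (real (card J) + 1) / ((real m + 1) * (real m + 2)))"
    by (simp add: power2_eq_square sum_product)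
qed

section \<open>Random words\<close>

text \<open>The possible outcomes of l draws, kept in order: counts are read off with
  \<open>count_list\<close>, and several words share one count vector.\<close>

definition words :: "nat \<Rightarrow> nat \<Rightarrow> nat list set" where
  "words m l = {xs. set xs \<subseteq> {..m} \<and> length xs = l}"

definition word_prob :: "(nat \<Rightarrow> real) \<Rightarrow> nat list \<Rightarrow> real" where
  "word_prob y xs = prod_list (map y xs)"

lemma word_prob_simps [simp]:
  "word_prob y [] = 1" "word_prob y (i # xs) = y i * word_prob y xs"
  by (simp_all add: word_prob_def)

lemma finite_words [simp]: "finite (words m l)"
  unfolding words_def by (rule finite_lists_length_eq) simp

lemma words_0 [simp]: "words m 0 = {[]}"
  by (auto simp: words_def)

lemma sum_words_Suc: "(\<Sum>xs\<in>words m (Suc l). F xs) = (\<Sum>i\<le>m. \<Sum>xs\<in>words m l. F (i # xs))"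
proof -
  have "words m (Suc l) = (\<lambda>(i, xs). i # xs) ` ({..m} \<times> words m l)"
    by (auto simp: words_def length_Suc_conv image_iff)
  then have "(\<Sum>xs\<in>words m (Suc l). F xs) = (\<Sum>(i, xs)\<in>{..m} \<times> words m l. F (i # xs))"
    by (simp add: sum.reindex inj_on_def split_def comp_def)
  then show ?thesis by (simp add: sum.cartesian_product)
qed

lemma word_prob_nonneg: "(\<And>i. 0 \<le> y i) \<Longrightarrow> 0 \<le> word_prob y xs"
  by (induction xs) simp_all

lemma measurable_word_prob [measurable]:
  assumes [measurable]: "\<And>i. (\<lambda>x. y x i) \<in> borel_measurable M"
  shows "(\<lambda>x. word_prob (y x) xs) \<in> borel_measurable M"
  by (induction xs) simp_all

lemma sum_count_words:
  "xs \<in> words m l \<Longrightarrow> (\<Sum>j\<le>m. count_list xs j) = l"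
proof (induction xs arbitrary: l)
  case Nil
  then show ?case by (simp add: words_def)
next
  case (Cons x xs)
  then have "xs \<in> words m (l - 1)" "x \<le> m" "l \<noteq> 0" by (auto simp: words_def)
  moreover have "(\<Sum>j\<le>m. count_list (x # xs) j) = (\<Sum>j\<le>m. count_list xs j + (if j = x then 1 else 0))"
    by (rule sum.cong) auto
  ultimately show ?case using Cons.IH[of "l - 1"] by (simp add: sum.distrib)
qed

lemma sum_word_prob:
  assumes "(\<Sum>i\<le>m. y i) = 1"
  shows "(\<Sum>xs\<in>words m l. word_prob y xs) = 1"
  by (induction l) (simp_all add: sum_words_Suc sum_distrib_left[symmetric] assms)

lemma sum_word_prob_count:
  assumes "(\<Sum>i\<le>m. y i) = 1" "j \<le> m"
  shows "(\<Sum>xs\<in>words m l. word_prob y xs * real (count_list xs j)) = real l * y j"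
proof (induction l)
  case (Suc l)
  have "(\<Sum>xs\<in>words m l. word_prob y (i # xs) * real (count_list (i # xs) j)) =
      y i * (real l * y j) + (if i = j then y i else 0)" for i
  proof -
    have "(\<Sum>xs\<in>words m l. word_prob y (i # xs) * real (count_list (i # xs) j)) =
       y i * (\<Sum>xs\<in>words m l. word_prob y xs * real (count_list xs j)) +
       (if i = j then y i else 0) * (\<Sum>xs\<in>words m l. word_prob y xs)"
      unfolding sum_distrib_left sum.distrib[symmetric] by (rule sum.cong) (auto simp: algebra_simps)
    then show ?thesis by (simp add: Suc.IH sum_word_prob[OF assms(1)])
  qed
  then show ?case
    using assms
    by (simp only: sum_words_Suc sum.distrib sum_distrib_right[symmetric]) (simp add: algebra_simps)
qed simp

text \<open>If the first letter is j, the count N of the remaining word becomes N + 1, and (N + 1)^2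
  = N^2 + 2 N + 1 brings in the first moment and the total mass.\<close>

lemma sum_word_prob_count_sq:
  assumes "(\<Sum>i\<le>m. y i) = 1" "j \<le> m"
  shows "(\<Sum>xs\<in>words m l. word_prob y xs * (real (count_list xs j))\<^sup>2) =
    real l * y j + real l * (real l - 1) * (y j)\<^sup>2"
proof (induction l)
  case (Suc l)
  have "(\<Sum>xs\<in>words m l. word_prob y (i # xs) * (real (count_list (i # xs) j))\<^sup>2) =
      y i * (real l * y j + real l * (real l - 1) * (y j)\<^sup>2) +
      (if i = j then y i * (2 * real l * y j + 1) else 0)" for i
  proof -
    have "(\<Sum>xs\<in>words m l. word_prob y (i # xs) * (real (count_list (i # xs) j))\<^sup>2) =
       y i * (\<Sum>xs\<in>words m l. word_prob y xs * (real (count_list xs j))\<^sup>2) +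
       ((if i = j then 2 * y i else 0) * (\<Sum>xs\<in>words m l. word_prob y xs * real (count_list xs j)) +
       (if i = j then y i else 0) * (\<Sum>xs\<in>words m l. word_prob y xs))"
      unfolding sum_distrib_left sum.distrib[symmetric]
      by (rule sum.cong) (auto simp: algebra_simps power2_eq_square)
    then show ?thesis
      by (simp add: Suc.IH sum_word_prob[OF assms(1)] sum_word_prob_count[OF assms] algebra_simps)
  qed
  then show ?case
    using assms
    by (simp only: sum_words_Suc sum.distrib sum_distrib_right[symmetric])
      (simp add: algebra_simps power2_eq_square)
qed simp

text \<open>The simplex conditions are what \<open>embed_pmf\<close> asks for, nonnegativity and
  total mass 1; vanishing beyond m makes the integral a finite sum.\<close>

lemma nn_integral_embed_simplex:
  assumes "y \<in> standard_simplex m"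
  shows "(\<integral>\<^sup>+i. G i \<partial>measure_pmf (embed_pmf y)) = (\<Sum>i\<le>m. ennreal (y i) * G i)"
proof -
  have y: "\<And>i. 0 \<le> y i" "\<And>i. i > m \<Longrightarrow> y i = 0" "(\<Sum>i\<le>m. y i) = 1"
    using assms by (auto simp: standard_simplex_def)
  have "(\<integral>\<^sup>+i. ennreal (y i) \<partial>count_space UNIV) = (\<Sum>i\<le>m. ennreal (y i))"
    by (rule nn_integral_count_space'[of "{..m}"]) (use y in \<open>auto simp: not_le[symmetric]\<close>)
  also have "\<dots> = 1" using y by (simp add: sum_ennreal)
  finally have pmf: "pmf (embed_pmf y) i = y i" for i
    using y(1) by (intro pmf_embed_pmf)
  have "(\<integral>\<^sup>+i. G i \<partial>measure_pmf (embed_pmf y)) = (\<Sum>i\<le>m. G i * ennreal (pmf (embed_pmf y) i))"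
    by (rule nn_integral_measure_pmf_support) (use y in \<open>auto simp: pmf set_pmf_eq not_le[symmetric]\<close>)
  then show ?thesis by (simp add: pmf mult.commute)
qed

text \<open>G is general in the induction because, once the first letter i is drawn, the integrand
  for the rest is \<open>G (i # xs)\<close>.\<close>

lemma nn_integral_replicate_simplex:
  assumes "y \<in> standard_simplex m"
  shows "(\<integral>\<^sup>+xs. G xs \<partial>measure_pmf (replicate_pmf l (embed_pmf y))) =
    (\<Sum>xs\<in>words m l. ennreal (word_prob y xs) * G xs)"
proof (induction l arbitrary: G)
  case (Suc l)
  have nn: "\<And>i. 0 \<le> y i" "\<And>xs. 0 \<le> word_prob y xs"
    using assms by (auto simp: standard_simplex_def intro!: word_prob_nonneg)
  show ?case
    by (simp add: Suc.IH nn_integral_embed_simplex[OF assms] sum_words_Suc sum_distrib_left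
        ennreal_mult nn mult.assoc)
qed simp

section \<open>Concentration\<close>

lemma compact_standard_simplex: "compact (standard_simplex m)"
  using compactin_standard_simplex[of m] by (simp add: euclidean_product_topology)

lemma continuous_on_component: "continuous_on S (\<lambda>z::'i \<Rightarrow> real. z j)"
  by (rule continuous_on_subset[OF continuous_on_product_coordinates]) simp

lemma standard_simplex_eqI:
  assumes "x \<in> standard_simplex m" "y \<in> standard_simplex m" "\<And>j. j \<le> m \<Longrightarrow> x j = y j"
  shows "x = y"
proof
  fix j show "x j = y j"
    using assms by (cases "j \<le> m") (auto simp: standard_simplex_def)
qed

text \<open>The pairs at which f differs by at least \<epsilon> form a compact set that misses the
  diagonal, so the squared distance has a positive minimum on it. There C = 2 B / minimum works,
  with B a bound for f; elsewhere \<epsilon> alone suffices.\<close>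

lemma quadratic_modulus_of_continuity:
  fixes f :: "(nat \<Rightarrow> real) \<Rightarrow> real"
  assumes f: "continuous_on (standard_simplex m) f" and "0 < \<epsilon>"
  obtains C where "0 \<le> C" "\<And>x y. x \<in> standard_simplex m \<Longrightarrow> y \<in> standard_simplex m \<Longrightarrow>
      \<bar>f x - f y\<bar> \<le> \<epsilon> + C * (\<Sum>j\<le>m. (x j - y j)\<^sup>2)"
proof -
  let ?S = "standard_simplex m"
  let ?q = "\<lambda>(x, y). \<Sum>j\<le>m. (x j - y j :: real)\<^sup>2"
  define g where "g = (\<lambda>(x, y). \<bar>f x - f y\<bar>)"
  define K where "K = (?S \<times> ?S) \<inter> g -` {\<epsilon>..}"
  have "continuous_on (?S \<times> ?S) g"
    unfolding g_def split_def
    by (intro continuous_intros continuous_on_compose2[OF f]) auto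
  then have "closedin (top_of_set (?S \<times> ?S)) K"
    unfolding K_def by (rule continuous_closedin_preimage) simp
  then have K: "compact K"
    using closedin_compact compact_Times[OF compact_standard_simplex compact_standard_simplex] by blast
  have "continuous_on K ?q"
    unfolding split_def
    by (intro continuous_intros continuous_on_compose2[OF continuous_on_component[of UNIV]]) auto
  obtain B where B: "\<And>x. x \<in> ?S \<Longrightarrow> \<bar>f x\<bar> \<le> B"
    using compact_imp_bounded[OF compact_continuous_image[OF f compact_standard_simplex]]
    unfolding bounded_iff by auto
  have B0: "0 \<le> B" using B nonempty_standard_simplex[of m] by fastforce
  have q0: "0 \<le> ?q p" for p by (auto simp: split_def intro: sum_nonneg)
  show ?thesis
  proof (cases "K = {}")
    case True
    show ?thesis
    proof (rule that[of 0])
      fix x y assume "x \<in> ?S" "y \<in> ?S"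
      with True have "\<not> \<epsilon> \<le> g (x, y)" unfolding K_def by blast
      then show "\<bar>f x - f y\<bar> \<le> \<epsilon> + 0 * (\<Sum>j\<le>m. (x j - y j)\<^sup>2)" by (simp add: g_def)
    qed simp
  next
    case False
    obtain p where p: "p \<in> K" "\<And>p'. p' \<in> K \<Longrightarrow> ?q p \<le> ?q p'"
      using continuous_attains_inf[OF K False \<open>continuous_on K ?q\<close>] by blast
    \<comment> \<open>Points of the simplex vanish beyond m, so zero distance in the coordinates up
      to m means equality, and then the difference of the values of f is 0 < \<epsilon>.\<close>
    have "?q p \<noteq> 0"
    proof
      assume "?q p = 0"
      then have "fst p j = snd p j" if "j \<le> m" for j
        using that by (simp add: split_def sum_nonneg_eq_0_iff)
      with p(1) have "fst p = snd p" by (intro standard_simplex_eqI[of _ m]) (auto simp: K_def)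
      with p(1) \<open>0 < \<epsilon>\<close> show False by (auto simp: K_def g_def split_def)
    qed
    then have c: "0 < ?q p" using q0[of p] by linarith
    show ?thesis
    proof (rule that[of "2 * B / ?q p"])
      show "0 \<le> 2 * B / ?q p" using B0 c by simp
      fix x y assume xy: "x \<in> ?S" "y \<in> ?S"
      show "\<bar>f x - f y\<bar> \<le> \<epsilon> + 2 * B / ?q p * (\<Sum>j\<le>m. (x j - y j)\<^sup>2)"
      proof (cases "(x, y) \<in> K")
        case True
        have "\<bar>f x - f y\<bar> \<le> 2 * B" using B[OF xy(1)] B[OF xy(2)] by linarith
        also have "\<dots> = 2 * B / ?q p * ?q p" using c by simp
        also have "\<dots> \<le> 2 * B / ?q p * ?q (x, y)"
          using p(2)[OF True] B0 c by (intro mult_left_mono) auto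
        finally show ?thesis using \<open>0 < \<epsilon>\<close> by simp
      next
        case False
        then have "\<bar>f x - f y\<bar> \<le> \<epsilon>" using xy by (auto simp: K_def g_def)
        moreover have "0 \<le> 2 * B / ?q p * ?q (x, y)"
          using B0 c q0[of "(x, y)"] by (intro mult_nonneg_nonneg divide_nonneg_nonneg) auto
        ultimately show ?thesis by simp
      qed
    qed
  qed
qed

text \<open>The sum on the right is the mean squared distance from Z to u, expanded into moments. In
  this form it is linear in a and b and can be averaged over words afterwards.\<close>

lemma (in prob_space) expectation_deviation_le:
  fixes f :: "(nat \<Rightarrow> real) \<Rightarrow> real"
  assumes Z: "\<And>\<omega>. \<omega> \<in> space M \<Longrightarrow> Z \<omega> \<in> standard_simplex m"
    and fZ [measurable]: "(\<lambda>\<omega>. f (Z \<omega>)) \<in> borel_measurable M"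
    and u: "u \<in> standard_simplex m"
    and a: "\<And>j. j \<le> m \<Longrightarrow> has_bochner_integral M (\<lambda>\<omega>. Z \<omega> j) (a j)"
    and b: "\<And>j. j \<le> m \<Longrightarrow> has_bochner_integral M (\<lambda>\<omega>. (Z \<omega> j)\<^sup>2) (b j)"
    and f: "\<And>x. x \<in> standard_simplex m \<Longrightarrow> \<bar>f x\<bar> \<le> B"
    and C: "\<And>x y. x \<in> standard_simplex m \<Longrightarrow> y \<in> standard_simplex m \<Longrightarrow>
      \<bar>f x - f y\<bar> \<le> \<epsilon> + C * (\<Sum>j\<le>m. (x j - y j)\<^sup>2)"
  shows "\<bar>expectation (\<lambda>\<omega>. f (Z \<omega>)) - f u\<bar> \<le> \<epsilon> + C * (\<Sum>j\<le>m. b j - 2 * u j * a j + (u j)\<^sup>2)"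
proof -
  have c: "has_bochner_integral M (\<lambda>_. k) k" for k :: real
    by (simp add: has_bochner_integral_iff prob_space)
  have *: "has_bochner_integral M (\<lambda>\<omega>. \<epsilon> + C * (\<Sum>j\<le>m. (Z \<omega> j)\<^sup>2 - 2 * u j * Z \<omega> j + (u j)\<^sup>2))
      (\<epsilon> + C * (\<Sum>j\<le>m. b j - 2 * u j * a j + (u j)\<^sup>2))"
    by (intro has_bochner_integral_add c has_bochner_integral_mult_right has_bochner_integral_sum
        has_bochner_integral_diff) (auto intro: a b)
  have int: "integrable M (\<lambda>\<omega>. f (Z \<omega>))"
    by (rule integrable_const_bound[where B=B]) (use f Z in \<open>auto intro!: AE_I2\<close>)
  have "\<bar>expectation (\<lambda>\<omega>. f (Z \<omega>)) - f u\<bar> = \<bar>expectation (\<lambda>\<omega>. f (Z \<omega>) - f u)\<bar>"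
    using int by (simp add: prob_space)
  also have "\<dots> \<le> expectation (\<lambda>\<omega>. \<bar>f (Z \<omega>) - f u\<bar>)"
    by (rule integral_abs_bound)
  also have "\<dots> \<le> expectation (\<lambda>\<omega>. \<epsilon> + C * (\<Sum>j\<le>m. (Z \<omega> j)\<^sup>2 - 2 * u j * Z \<omega> j + (u j)\<^sup>2))"
  proof (rule integral_mono)
    show "integrable M (\<lambda>\<omega>. \<bar>f (Z \<omega>) - f u\<bar>)" using int by auto
    show "integrable M (\<lambda>\<omega>. \<epsilon> + C * (\<Sum>j\<le>m. (Z \<omega> j)\<^sup>2 - 2 * u j * Z \<omega> j + (u j)\<^sup>2))"
      using * by (rule integrable.intros)
    fix \<omega> assume "\<omega> \<in> space M"
    then show "\<bar>f (Z \<omega>) - f u\<bar> \<le> \<epsilon> + C * (\<Sum>j\<le>m. (Z \<omega> j)\<^sup>2 - 2 * u j * Z \<omega> j + (u j)\<^sup>2)"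
      using C[OF Z u] by (simp add: power2_diff algebra_simps)
  qed
  also have "\<dots> = \<epsilon> + C * (\<Sum>j\<le>m. b j - 2 * u j * a j + (u j)\<^sup>2)"
    using * by (rule has_bochner_integral_integral_eq)
  finally show ?thesis .
qed

text \<open>The left side is the mean squared error in coordinate j: the bracket is the error given
  the word, for a Dirichlet-type point with parameter count + s out of a total of l + r.\<close>

lemma word_prob_variance_le:
  fixes y :: "nat \<Rightarrow> real" and s r :: real
  assumes "y \<in> standard_simplex m" "j \<le> m" "0 \<le> s" "0 \<le> r" "0 < l"
  shows "(\<Sum>xs\<in>words m l. word_prob y xs *
      ((real (count_list xs j) + s) * (real (count_list xs j) + s + 1) / ((real l + r) * (real l + r + 1))
        - 2 * y j * ((real (count_list xs j) + s) / (real l + r)) + (y j)\<^sup>2))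
    \<le> (2 + r * (r + 1) + s * (s + 1)) / real l"
proof -
  let ?c = "\<lambda>xs. real (count_list xs j)" and ?l = "real l"
  have y: "0 \<le> y j" "y j \<le> 1" "(\<Sum>i\<le>m. y i) = 1"
    using assms by (auto simp: standard_simplex_def)
  have pos: "0 < ?l" "0 < ?l + r" "0 < ?l + r + 1" using assms by auto
  have l1: "1 \<le> ?l" using assms by simp
  define A where "A = 1 / ((?l + r) * (?l + r + 1))"
  define D where "D = 1 / (?l + r)"
  have "(\<Sum>xs\<in>words m l. word_prob y xs *
      ((?c xs + s) * (?c xs + s + 1) / ((?l + r) * (?l + r + 1))
        - 2 * y j * ((?c xs + s) / (?l + r)) + (y j)\<^sup>2)) =
     (\<Sum>xs\<in>words m l. A * (word_prob y xs * (?c xs)\<^sup>2)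
       + (A * (2 * s + 1) - 2 * y j * D) * (word_prob y xs * ?c xs)
       + (A * (s * (s + 1)) - 2 * y j * D * s + (y j)\<^sup>2) * word_prob y xs)"
    by (rule sum.cong) (simp_all add: A_def[symmetric] D_def[symmetric] divide_inverse A_def D_def
      algebra_simps power2_eq_square)
  also have "\<dots> = A * (?l * y j + ?l * (?l - 1) * (y j)\<^sup>2)
       + (A * (2 * s + 1) - 2 * y j * D) * (?l * y j)
       + (A * (s * (s + 1)) - 2 * y j * D * s + (y j)\<^sup>2)"
    using y assms(2)
    by (simp only: sum.distrib sum_distrib_left[symmetric] sum_word_prob sum_word_prob_count
      sum_word_prob_count_sq mult_1_right)
  \<comment> \<open>Over the common denominator the terms quadratic in l cancel. What remains is
    linear in l above and quadratic below, which is the source of the rate 1/l.\<close>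
  also have "\<dots> = (2 * ?l * (y j * (1 - y j)) + r * (r + 1) * (y j)\<^sup>2 - 2 * s * (r + 1) * y j + s * (s + 1))
      / ((?l + r) * (?l + r + 1))"
    using pos by (simp add: A_def D_def divide_simps) (simp add: algebra_simps power2_eq_square)
  \<comment> \<open>The three summands of the constant bound y (1 - y) by 1, the square of y by l,
    and 1 by l; the term with \<open>2 * s * (r + 1)\<close> is subtracted and nonnegative, hence
    dropped.\<close>
  also have "\<dots> \<le> (2 + r * (r + 1) + s * (s + 1)) * ?l / (?l * ?l)"
  proof (rule frac_le)
    have "y j * (1 - y j) \<le> 1" using y by (intro mult_le_one) auto
    then have "2 * ?l * (y j * (1 - y j)) \<le> 2 * ?l"
      using mult_left_mono[of "y j * (1 - y j)" 1 "2 * ?l"] pos by simp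
    moreover have "r * (r + 1) * (y j)\<^sup>2 \<le> r * (r + 1) * ?l"
    proof (rule mult_left_mono)
      have "(y j)\<^sup>2 \<le> 1" using y by (simp add: power_le_one)
      then show "(y j)\<^sup>2 \<le> ?l" using l1 by linarith
    qed (use assms in auto)
    moreover have "0 \<le> 2 * s * (r + 1) * y j" using assms y by simp
    moreover have "s * (s + 1) \<le> s * (s + 1) * ?l"
      using mult_left_mono[OF l1, of "s * (s + 1)"] assms by simp
    ultimately show "2 * ?l * (y j * (1 - y j)) + r * (r + 1) * (y j)\<^sup>2 - 2 * s * (r + 1) * y j + s * (s + 1)
      \<le> (2 + r * (r + 1) + s * (s + 1)) * ?l"
      unfolding distrib_right by linarith
    show "?l * ?l \<le> (?l + r) * (?l + r + 1)" using assms by (intro mult_mono) auto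
  qed (use assms in auto)
  also have "\<dots> = (2 + r * (r + 1) + s * (s + 1)) / ?l" using pos by simp
  finally show ?thesis .
qed

text \<open>The common core of both parts. \<open>P l xs\<close> with \<open>Z l xs\<close> is the
  experiment performed once the word is known, and the sum is the expectation of f after averaging
  the word probabilities over y. Length \<open>Suc l\<close> keeps the denominators
  positive.\<close>

lemma (in prob_space) word_mixture_tendsto:
  fixes f :: "(nat \<Rightarrow> real) \<Rightarrow> real" and s r :: real
  assumes y: "\<And>x. x \<in> space M \<Longrightarrow> y x \<in> standard_simplex m"
    and y_meas [measurable]: "\<And>j. (\<lambda>x. y x j) \<in> borel_measurable M"
    and fy [measurable]: "(\<lambda>x. f (y x)) \<in> borel_measurable M"
    and f: "continuous_on (standard_simplex m) f"
    and P: "\<And>l xs. xs \<in> words m (Suc l) \<Longrightarrow> prob_space (P l xs)"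
    and Z: "\<And>l xs \<omega>. xs \<in> words m (Suc l) \<Longrightarrow> \<omega> \<in> space (P l xs) \<Longrightarrow> Z l xs \<omega> \<in> standard_simplex m"
    and fZ: "\<And>l xs. xs \<in> words m (Suc l) \<Longrightarrow> (\<lambda>\<omega>. f (Z l xs \<omega>)) \<in> borel_measurable (P l xs)"
    and fst: "\<And>l xs j. xs \<in> words m (Suc l) \<Longrightarrow> j \<le> m \<Longrightarrow>
      has_bochner_integral (P l xs) (\<lambda>\<omega>. Z l xs \<omega> j) ((real (count_list xs j) + s) / (real (Suc l) + r))"
    and snd: "\<And>l xs j. xs \<in> words m (Suc l) \<Longrightarrow> j \<le> m \<Longrightarrow>
      has_bochner_integral (P l xs) (\<lambda>\<omega>. (Z l xs \<omega> j)\<^sup>2)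
        ((real (count_list xs j) + s) * (real (count_list xs j) + s + 1) /
          ((real (Suc l) + r) * (real (Suc l) + r + 1)))"
    and "0 \<le> s" "0 \<le> r"
  shows "(\<lambda>l. \<Sum>xs\<in>words m (Suc l). expectation (\<lambda>x. word_prob (y x) xs) * (\<integral>\<omega>. f (Z l xs \<omega>) \<partial>P l xs))
    \<longlonglongrightarrow> expectation (\<lambda>x. f (y x))"
proof (rule LIMSEQ_I)
  fix \<epsilon> :: real assume "0 < \<epsilon>"
  then have "0 < \<epsilon> / 2" by simp
  obtain C where C: "0 \<le> C" "\<And>u v. u \<in> standard_simplex m \<Longrightarrow> v \<in> standard_simplex m \<Longrightarrow>
      \<bar>f u - f v\<bar> \<le> \<epsilon> / 2 + C * (\<Sum>j\<le>m. (u j - v j)\<^sup>2)"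
    using quadratic_modulus_of_continuity[OF f \<open>0 < \<epsilon> / 2\<close>] by blast
  obtain B where B: "\<And>u. u \<in> standard_simplex m \<Longrightarrow> \<bar>f u\<bar> \<le> B"
    using compact_imp_bounded[OF compact_continuous_image[OF f compact_standard_simplex]]
    unfolding bounded_iff by auto
  let ?K = "2 + r * (r + 1) + s * (s + 1)"
  let ?I = "\<lambda>l xs. \<integral>\<omega>. f (Z l xs \<omega>) \<partial>P l xs"
  let ?D = "C * (\<Sum>j\<le>m. ?K)"
  \<comment> \<open>The bound does not depend on x, so it can be integrated over the law of y
    directly, without dominated convergence.\<close>
  have pointwise: "\<bar>(\<Sum>xs\<in>words m (Suc l). word_prob (y x) xs * ?I l xs) - f (y x)\<bar>
      \<le> \<epsilon> / 2 + ?D / real (Suc l)" if x: "x \<in> space M" for x l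
  proof -
    let ?u = "y x" and ?W = "words m (Suc l)"
    let ?v = "\<lambda>xs j. (real (count_list xs j) + s) * (real (count_list xs j) + s + 1) /
          ((real (Suc l) + r) * (real (Suc l) + r + 1))
        - 2 * ?u j * ((real (count_list xs j) + s) / (real (Suc l) + r)) + (?u j)\<^sup>2"
    have u: "?u \<in> standard_simplex m" using y x by simp
    have w: "(\<Sum>xs\<in>?W. word_prob ?u xs) = 1" "\<And>xs. 0 \<le> word_prob ?u xs"
      using u by (auto simp: standard_simplex_def intro!: sum_word_prob word_prob_nonneg)
    have "(\<Sum>xs\<in>?W. word_prob ?u xs * ?I l xs) - f ?u = (\<Sum>xs\<in>?W. word_prob ?u xs * (?I l xs - f ?u))"
      by (simp add: algebra_simps sum_subtractf sum_distrib_left[symmetric] w)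
    also have "\<bar>\<dots>\<bar> \<le> (\<Sum>xs\<in>?W. \<bar>word_prob ?u xs * (?I l xs - f ?u)\<bar>)"
      by (rule sum_abs)
    also have "\<dots> \<le> (\<Sum>xs\<in>?W. word_prob ?u xs * (\<epsilon> / 2 + C * (\<Sum>j\<le>m. ?v xs j)))"
    proof (rule sum_mono)
      fix xs assume xs: "xs \<in> ?W"
      interpret Q: prob_space "P l xs" using P[OF xs] .
      have "\<bar>?I l xs - f ?u\<bar> \<le> \<epsilon> / 2 + C * (\<Sum>j\<le>m. ?v xs j)"
        by (rule Q.expectation_deviation_le[where Z="Z l xs" and B=B])
          (fact Z[OF xs] fZ[OF xs] u fst[OF xs] snd[OF xs] B C(2))+
      then show "\<bar>word_prob ?u xs * (?I l xs - f ?u)\<bar> \<le>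
          word_prob ?u xs * (\<epsilon> / 2 + C * (\<Sum>j\<le>m. ?v xs j))"
        using w(2)[of xs] by (simp only: abs_mult abs_of_nonneg mult_left_mono)
    qed
    also have "\<dots> = \<epsilon> / 2 * (\<Sum>xs\<in>?W. word_prob ?u xs) +
        C * (\<Sum>xs\<in>?W. \<Sum>j\<le>m. word_prob ?u xs * ?v xs j)"
      unfolding sum_distrib_left sum.distrib[symmetric] by (simp add: distrib_left sum_distrib_left mult_ac)
    \<comment> \<open>With the sum over words innermost, each coordinate is an instance of
      \<open>word_prob_variance_le\<close>.\<close>
    also have "\<dots> = \<epsilon> / 2 + C * (\<Sum>j\<le>m. \<Sum>xs\<in>?W. word_prob ?u xs * ?v xs j)"
      unfolding w by (subst sum.swap) simp
    also have "\<dots> \<le> \<epsilon> / 2 + C * (\<Sum>j\<le>m. ?K / real (Suc l))"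
      using u assms(10,11) C(1) by (intro add_left_mono mult_left_mono sum_mono word_prob_variance_le) auto
    finally show ?thesis by simp
  qed
  have "(\<lambda>l. ?D / real (Suc l)) \<longlonglongrightarrow> 0"
    by (intro LIMSEQ_Suc lim_const_over_n)
  then have "\<forall>\<^sub>F l in sequentially. ?D / real (Suc l) < \<epsilon> / 2"
    using \<open>0 < \<epsilon> / 2\<close> by (rule order_tendstoD)
  then obtain N where N: "\<And>l. N \<le> l \<Longrightarrow> ?D / real (Suc l) < \<epsilon> / 2"
    unfolding eventually_sequentially by blast
  have int_f: "integrable M (\<lambda>x. f (y x))"
    by (rule integrable_const_bound[where B=B]) (use B y in \<open>auto intro!: AE_I2\<close>)
  have int_w: "integrable M (\<lambda>x. word_prob (y x) xs)" if "xs \<in> words m l" for xs l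
  proof (rule integrable_const_bound[where B=1])
    show "AE x in M. norm (word_prob (y x) xs) \<le> 1"
    proof (rule AE_I2)
      fix x assume "x \<in> space M"
      then have u: "\<And>i. 0 \<le> y x i" "(\<Sum>i\<le>m. y x i) = 1" using y by (auto simp: standard_simplex_def)
      have "word_prob (y x) xs \<le> (\<Sum>xs\<in>words m l. word_prob (y x) xs)"
        using that u by (intro member_le_sum word_prob_nonneg) auto
      then show "norm (word_prob (y x) xs) \<le> 1"
        using u by (simp add: sum_word_prob word_prob_nonneg)
    qed
  qed measurable
  show "\<exists>N. \<forall>l\<ge>N. norm ((\<Sum>xs\<in>words m (Suc l). expectation (\<lambda>x. word_prob (y x) xs) * ?I l xs)
      - expectation (\<lambda>x. f (y x))) < \<epsilon>"
  proof (intro exI[of _ N] allI impI)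
    fix l assume "N \<le> l"
    let ?g = "\<lambda>x. (\<Sum>xs\<in>words m (Suc l). word_prob (y x) xs * ?I l xs) - f (y x)"
    have int_s: "integrable M (\<lambda>x. \<Sum>xs\<in>words m (Suc l). word_prob (y x) xs * ?I l xs)"
      using int_w by (intro Bochner_Integration.integrable_sum) auto
    have "(\<Sum>xs\<in>words m (Suc l). expectation (\<lambda>x. word_prob (y x) xs) * ?I l xs)
        - expectation (\<lambda>x. f (y x)) = expectation ?g"
      using int_s int_f int_w by (simp add: Bochner_Integration.integral_sum)
    also have "norm \<dots> \<le> expectation (\<lambda>x. \<bar>?g x\<bar>)"
      unfolding real_norm_def by (rule integral_abs_bound)
    also have "\<dots> \<le> expectation (\<lambda>x. \<epsilon> / 2 + ?D / real (Suc l))"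
      by (rule integral_mono) (use int_s int_f pointwise in auto)
    also have "\<dots> = \<epsilon> / 2 + ?D / real (Suc l)" by (simp add: prob_space)
    also have "\<dots> < \<epsilon>" using N[OF \<open>N \<le> l\<close>] by linarith
    finally show "norm ((\<Sum>xs\<in>words m (Suc l). expectation (\<lambda>x. word_prob (y x) xs) * ?I l xs)
      - expectation (\<lambda>x. f (y x))) < \<epsilon>" .
  qed
qed

section \<open>Polynomial densities\<close>

lemma borel_probD:
  assumes "L \<in> borel_prob T"
  shows "prob_space L" "sets L = sets (restrict_space borel T)" "space L = T"
proof -
  show "prob_space L" and s: "sets L = sets (restrict_space borel T)"
    using assms by (auto simp: borel_prob_def space_prob_algebra)
  show "space L = T" using sets_eq_imp_space_eq[OF s] by (simp add: space_restrict_space)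
qed

text \<open>The counts are a function of the word, so integrating over their law is summing over
  words; words with equal counts stay separate summands.\<close>

lemma emeasure_multinomial_dirichlet:
  assumes "y \<in> standard_simplex m" "A \<in> sets (restrict_space borel (standard_simplex m))"
  shows "emeasure (measure_pmf (multinomial_pmf l y) \<bind> (\<lambda>\<alpha>. dirichlet m (\<lambda>j. real (\<alpha> j) + 1))) A =
    (\<Sum>xs\<in>words m l. ennreal (word_prob y xs) * emeasure (dirichlet m (\<lambda>j. real (count_list xs j) + 1)) A)"
proof -
  let ?N = "restrict_space borel (standard_simplex m)"
  have "(\<lambda>\<alpha>. dirichlet m (\<lambda>j. real (\<alpha> j) + 1)) \<in> measure_pmf (multinomial_pmf l y) \<rightarrow>\<^sub>M subprob_algebra ?N"
    by (auto simp: space_subprob_algebra intro: prob_space_dirichlet prob_space_imp_subprob_space)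
  then have "emeasure (measure_pmf (multinomial_pmf l y) \<bind> (\<lambda>\<alpha>. dirichlet m (\<lambda>j. real (\<alpha> j) + 1))) A =
      (\<integral>\<^sup>+\<alpha>. emeasure (dirichlet m (\<lambda>j. real (\<alpha> j) + 1)) A \<partial>measure_pmf (multinomial_pmf l y))"
    using assms(2) by (intro emeasure_bind[where N="?N"]) auto
  also have "\<dots> = (\<Sum>xs\<in>words m l. ennreal (word_prob y xs) *
      emeasure (dirichlet m (\<lambda>j. real (count_list xs j) + 1)) A)"
    unfolding multinomial_pmf_def nn_integral_map_pmf by (rule nn_integral_replicate_simplex[OF assms(1)])
  finally show ?thesis .
qed

text \<open>Measurability in y is not visible through \<open>embed_pmf\<close>, but on the simplex
  the mass of each set is a finite sum whose coefficients \<open>word_prob y xs\<close> are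
  monomials in y.\<close>

lemma measurable_multinomial_dirichlet:
  "(\<lambda>y. measure_pmf (multinomial_pmf l y) \<bind> (\<lambda>\<alpha>. dirichlet m (\<lambda>j. real (\<alpha> j) + 1)))
    \<in> restrict_space borel (standard_simplex m) \<rightarrow>\<^sub>M prob_algebra (restrict_space borel (standard_simplex m))"
  (is "?K \<in> ?N \<rightarrow>\<^sub>M _")
proof (intro measurable_prob_algebraI measurable_subprob_algebra)
  have N: "space ?N = standard_simplex m" by (simp add: space_restrict_space)
  show sets_K: "sets (?K y) = sets ?N" for y
    by (rule sets_bind) auto
  show prob: "prob_space (?K y)" if y: "y \<in> space ?N" for y
  proof
    have u: "\<And>i. 0 \<le> y i" "(\<Sum>i\<le>m. y i) = 1" using y by (auto simp: standard_simplex_def N)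
    have "emeasure (?K y) (space (?K y)) = emeasure (?K y) (standard_simplex m)"
      using sets_eq_imp_space_eq[OF sets_K, of y] by (simp add: N)
    also have "\<dots> = (\<Sum>xs\<in>words m l. ennreal (word_prob y xs))"
      using y N sets.top[of ?N] prob_space.emeasure_space_1[OF prob_space_dirichlet]
      by (subst emeasure_multinomial_dirichlet) (auto intro!: sum.cong)
    also have "\<dots> = 1"
      using u by (subst sum_ennreal) (auto simp: word_prob_nonneg sum_word_prob)
    finally show "emeasure (?K y) (space (?K y)) = 1" .
  qed
  show "subprob_space (?K y)" if "y \<in> space ?N" for y
    using prob[OF that] by (rule prob_space_imp_subprob_space)
  fix A assume A: "A \<in> sets ?N"
  show "(\<lambda>y. emeasure (?K y) A) \<in> borel_measurable ?N"
  proof (subst measurable_cong)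
    show "emeasure (?K y) A = (\<Sum>xs\<in>words m l. ennreal (word_prob y xs) *
        emeasure (dirichlet m (\<lambda>j. real (count_list xs j) + 1)) A)" if "y \<in> space ?N" for y
      using that A by (intro emeasure_multinomial_dirichlet) (auto simp: N)
  qed measurable
qed

text \<open>The probability of the word when y is itself drawn from Y. The same numbers give the
  coefficients of the polynomial density and, in part (2), the weights of the simplices.\<close>

definition word_coeff :: "(nat \<Rightarrow> real) measure \<Rightarrow> nat list \<Rightarrow> real" where
  "word_coeff Y xs = (\<integral>y. word_prob y xs \<partial>Y)"

context
  fixes m :: nat and Y :: "(nat \<Rightarrow> real) measure"
  assumes Y: "Y \<in> borel_prob (standard_simplex m)"
begin

lemma word_coeff_nonneg: "0 \<le> word_coeff Y xs"
  unfolding word_coeff_def using borel_probD[OF Y]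
  by (intro integral_nonneg_AE AE_I2 word_prob_nonneg) (auto simp: standard_simplex_def)

lemma nn_integral_word_prob:
  assumes "xs \<in> words m l"
  shows "(\<integral>\<^sup>+y. ennreal (word_prob y xs) \<partial>Y) = ennreal (word_coeff Y xs)"
proof -
  interpret prob_space Y using borel_probD[OF Y] by simp
  note [measurable_cong] = borel_probD(2)[OF Y]
  have nn: "0 \<le> word_prob y xs" "word_prob y xs \<le> 1" if "y \<in> space Y" for y
  proof -
    have u: "\<And>i. 0 \<le> y i" "(\<Sum>i\<le>m. y i) = 1"
      using that borel_probD(3)[OF Y] by (auto simp: standard_simplex_def)
    show "0 \<le> word_prob y xs" using u by (simp add: word_prob_nonneg)
    have "word_prob y xs \<le> (\<Sum>xs\<in>words m l. word_prob y xs)"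
      using assms u by (intro member_le_sum word_prob_nonneg) auto
    then show "word_prob y xs \<le> 1" using u by (simp add: sum_word_prob)
  qed
  have "integrable Y (\<lambda>y. word_prob y xs)"
    by (rule integrable_const_bound[where B=1]) (use nn in \<open>auto intro!: AE_I2\<close>)
  then show ?thesis unfolding word_coeff_def
    by (rule nn_integral_eq_integral) (use nn in auto)
qed

lemma Y_hat_in_borel_prob: "Y_hat m Y l \<in> borel_prob (standard_simplex m)"
proof -
  let ?N = "restrict_space borel (standard_simplex m)"
  note K = measurable_multinomial_dirichlet[of l m]
  have "Y \<in> space (prob_algebra ?N)" using Y by (simp add: borel_prob_def)
  then show ?thesis
    unfolding Y_hat_def borel_prob_def
    using K by (simp add: space_prob_algebra prob_space_bind' sets_bind')
qed

text \<open>The point y enters the kernel only through \<open>word_prob y xs\<close>, so integrating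
  over Y leaves a finite combination of Dirichlet densities with constant weights.\<close>

lemma Y_hat_eq_density:
  "Y_hat m Y l = density (simplex_measure m)
    (\<lambda>z. ennreal (\<Sum>xs\<in>words m l. word_coeff Y xs * dirichlet_density m (count_list xs) z))"
proof (rule measure_eqI)
  let ?N = "restrict_space borel (standard_simplex m)"
  note [measurable_cong] = borel_probD(2)[OF Y]
  show sets_eq: "sets (Y_hat m Y l) = sets (density (simplex_measure m)
      (\<lambda>z. ennreal (\<Sum>xs\<in>words m l. word_coeff Y xs * dirichlet_density m (count_list xs) z)))"
    using borel_probD[OF Y_hat_in_borel_prob[of l]] by simp
  fix A assume "A \<in> sets (Y_hat m Y l)"
  then have A: "A \<in> sets ?N" using sets_eq by simp
  have A' [measurable]: "A \<in> sets (simplex_measure m)" using A by simp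
  have "emeasure (Y_hat m Y l) A = (\<integral>\<^sup>+y. emeasure (measure_pmf (multinomial_pmf l y) \<bind>
      (\<lambda>\<alpha>. dirichlet m (\<lambda>j. real (\<alpha> j) + 1))) A \<partial>Y)"
    unfolding Y_hat_def using measurable_multinomial_dirichlet Y A
    by (intro emeasure_bind_prob_algebra) (auto simp: borel_prob_def)
  also have "\<dots> = (\<integral>\<^sup>+y. (\<Sum>xs\<in>words m l. ennreal (word_prob y xs) *
      emeasure (dirichlet m (\<lambda>j. real (count_list xs j) + 1)) A) \<partial>Y)"
    using A borel_probD(3)[OF Y] by (intro nn_integral_cong emeasure_multinomial_dirichlet) auto
  also have "\<dots> = (\<Sum>xs\<in>words m l. \<integral>\<^sup>+y. ennreal (word_prob y xs) *
      emeasure (dirichlet m (\<lambda>j. real (count_list xs j) + 1)) A \<partial>Y)"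
    by (rule nn_integral_sum) measurable
  also have "\<dots> = (\<Sum>xs\<in>words m l. ennreal (word_coeff Y xs) *
      emeasure (dirichlet m (\<lambda>j. real (count_list xs j) + 1)) A)"
  proof (rule sum.cong)
    fix xs assume xs: "xs \<in> words m l"
    have "(\<integral>\<^sup>+y. ennreal (word_prob y xs) * emeasure (dirichlet m (\<lambda>j. real (count_list xs j) + 1)) A \<partial>Y)
      = (\<integral>\<^sup>+y. ennreal (word_prob y xs) \<partial>Y) * emeasure (dirichlet m (\<lambda>j. real (count_list xs j) + 1)) A"
      by (rule nn_integral_multc) measurable
    then show "(\<integral>\<^sup>+y. ennreal (word_prob y xs) * emeasure (dirichlet m (\<lambda>j. real (count_list xs j) + 1)) A \<partial>Y)
      = ennreal (word_coeff Y xs) * emeasure (dirichlet m (\<lambda>j. real (count_list xs j) + 1)) A"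
      by (simp add: nn_integral_word_prob[OF xs])
  qed simp
  also have "\<dots> = (\<Sum>xs\<in>words m l. \<integral>\<^sup>+z. ennreal (word_coeff Y xs) *
      (ennreal (dirichlet_density m (count_list xs) z) * indicator A z) \<partial>simplex_measure m)"
    unfolding dirichlet_nat
    by (intro sum.cong refl) (subst emeasure_density, measurable, subst nn_integral_cmult, measurable)
  also have "\<dots> = (\<integral>\<^sup>+z. (\<Sum>xs\<in>words m l. ennreal (word_coeff Y xs) *
      (ennreal (dirichlet_density m (count_list xs) z) * indicator A z)) \<partial>simplex_measure m)"
    by (rule nn_integral_sum[symmetric]) measurable
  also have "\<dots> = (\<integral>\<^sup>+z. ennreal (\<Sum>xs\<in>words m l. word_coeff Y xs *
      dirichlet_density m (count_list xs) z) * indicator A z \<partial>simplex_measure m)"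
  proof (rule nn_integral_cong)
    fix z assume "z \<in> space (simplex_measure m)"
    then have nn: "0 \<le> dirichlet_density m (count_list xs) z" for xs
      by (simp add: dirichlet_density_nonneg)
    show "(\<Sum>xs\<in>words m l. ennreal (word_coeff Y xs) *
      (ennreal (dirichlet_density m (count_list xs) z) * indicator A z)) =
      ennreal (\<Sum>xs\<in>words m l. word_coeff Y xs * dirichlet_density m (count_list xs) z) * indicator A z"
      using nn word_coeff_nonneg
      by (simp add: sum_distrib_right ennreal_mult mult.assoc flip: sum_ennreal)
  qed
  also have "\<dots> = emeasure (density (simplex_measure m)
      (\<lambda>z. ennreal (\<Sum>xs\<in>words m l. word_coeff Y xs * dirichlet_density m (count_list xs) z))) A"
    by (subst emeasure_density) measurable
  finally show "emeasure (Y_hat m Y l) A = \<dots>" .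
qed

text \<open>Computed through the density instead of the nested \<open>bind\<close>, this is
  linearity over a finite sum; boundedness of f supplies integrability of each term.\<close>

lemma integral_Y_hat:
  fixes f :: "(nat \<Rightarrow> real) \<Rightarrow> real"
  assumes f [measurable]: "f \<in> borel_measurable (restrict_space borel (standard_simplex m))"
    and B: "\<And>z. z \<in> standard_simplex m \<Longrightarrow> \<bar>f z\<bar> \<le> B"
  shows "(\<integral>z. f z \<partial>Y_hat m Y l) =
    (\<Sum>xs\<in>words m l. word_coeff Y xs * (\<integral>z. f z \<partial>dirichlet m (\<lambda>j. real (count_list xs j) + 1)))"
proof -
  let ?d = "\<lambda>xs. dirichlet_density m (count_list xs)"
  have int: "integrable (simplex_measure m) (\<lambda>z. ?d xs z * f z)" for xs
  proof -
    interpret prob_space "dirichlet m (\<lambda>j. real (count_list xs j) + 1)"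
      by (rule prob_space_dirichlet)
    have "integrable (dirichlet m (\<lambda>j. real (count_list xs j) + 1)) f"
      by (rule integrable_const_bound[where B=B]) (use B in \<open>auto intro!: AE_I2\<close>)
    then show ?thesis
      unfolding dirichlet_nat
      by (subst (asm) integrable_density) (auto intro!: AE_I2 dirichlet_density_nonneg)
  qed
  have d: "(\<integral>z. f z \<partial>dirichlet m (\<lambda>j. real (count_list xs j) + 1)) =
      (\<integral>z. ?d xs z * f z \<partial>simplex_measure m)" for xs
    unfolding dirichlet_nat
    by (subst integral_density) (auto intro!: AE_I2 dirichlet_density_nonneg)
  have "(\<integral>z. f z \<partial>Y_hat m Y l) =
      (\<integral>z. (\<Sum>xs\<in>words m l. word_coeff Y xs * ?d xs z) *\<^sub>R f z \<partial>simplex_measure m)"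
    unfolding Y_hat_eq_density
    by (rule integral_density)
      (auto intro!: AE_I2 sum_nonneg mult_nonneg_nonneg dirichlet_density_nonneg word_coeff_nonneg)
  also have "\<dots> = (\<integral>z. (\<Sum>xs\<in>words m l. word_coeff Y xs * (?d xs z * f z)) \<partial>simplex_measure m)"
    by (simp add: sum_distrib_right mult.assoc)
  also have "\<dots> = (\<Sum>xs\<in>words m l. word_coeff Y xs * (\<integral>z. ?d xs z * f z \<partial>simplex_measure m))"
    using int by (subst Bochner_Integration.integral_sum) auto
  finally show ?thesis by (simp add: d)
qed

lemma weak_conv_on_Y_hat: "weak_conv_on (standard_simplex m) (\<lambda>l. Y_hat m Y (l + 1)) Y"
  unfolding weak_conv_on_def
proof (intro conjI allI impI)
  let ?S = "standard_simplex m"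
  show "Y \<in> borel_prob ?S" by fact
  show "Y_hat m Y (l + 1) \<in> borel_prob ?S" for l by (rule Y_hat_in_borel_prob)
  fix f :: "(nat \<Rightarrow> real) \<Rightarrow> real" assume f: "continuous_on ?S f" and "bounded (f ` ?S)"
  then obtain B where B: "\<And>z. z \<in> ?S \<Longrightarrow> \<bar>f z\<bar> \<le> B" unfolding bounded_iff by auto
  have [measurable]: "f \<in> borel_measurable (restrict_space borel ?S)"
    using f by (rule borel_measurable_continuous_on_restrict)
  interpret prob_space Y using borel_probD[OF Y] by simp
  note [measurable_cong] = borel_probD(2)[OF Y]
  have "(\<lambda>l. \<Sum>xs\<in>words m (Suc l). expectation (\<lambda>y. word_prob y xs) *
      (\<integral>z. f z \<partial>dirichlet m (\<lambda>j. real (count_list xs j) + 1))) \<longlonglongrightarrow> expectation f"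
  \<comment> \<open>The Dirichlet parameters are count + 1 in each of m + 1 coordinates, hence s = 1
    and a total of \<open>Suc l\<close> plus r = m + 1.\<close>
  proof (rule word_mixture_tendsto[where Z="\<lambda>l xs z. z" and s=1 and r="real (m + 1)"])
    fix l xs j assume xs: "xs \<in> words m (Suc l)" and j: "j \<le> m"
    have n: "(\<Sum>j\<le>m. count_list xs j) = Suc l" using xs by (rule sum_count_words)
    show "has_bochner_integral (dirichlet m (\<lambda>j. real (count_list xs j) + 1)) (\<lambda>z. z j)
        ((real (count_list xs j) + 1) / (real (Suc l) + real (m + 1)))"
      using has_bochner_integral_dirichlet_fst[OF j, of "count_list xs"] unfolding n .
    show "has_bochner_integral (dirichlet m (\<lambda>j. real (count_list xs j) + 1)) (\<lambda>z. (z j)\<^sup>2)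
        ((real (count_list xs j) + 1) * (real (count_list xs j) + 1 + 1) /
          ((real (Suc l) + real (m + 1)) * (real (Suc l) + real (m + 1) + 1)))"
      using has_bochner_integral_dirichlet_snd[OF j, of "count_list xs"] unfolding n
      by (simp only: add.assoc one_add_one)
  qed (use borel_probD(3)[OF Y] f in \<open>auto intro: prob_space_dirichlet\<close>)
  then show "(\<lambda>l. \<integral>z. f z \<partial>Y_hat m Y (l + 1)) \<longlonglongrightarrow> (\<integral>z. f z \<partial>Y)"
    by (subst integral_Y_hat[where B=B]) (use B in \<open>auto simp: word_coeff_def\<close>)
qed

end

section \<open>From the density to a formal polynomial in \<open>R_plus\<close>\<close>

lemma eval_mpoly_superset:
  assumes "finite K" "Poly_Mapping.keys p \<subseteq> K"
  shows "eval_mpoly p z = (\<Sum>a\<in>K. Poly_Mapping.lookup p a *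
        (\<Prod>j\<in>Poly_Mapping.keys a. z j ^ Poly_Mapping.lookup a j))"
  unfolding eval_mpoly_def
  by (rule sum.mono_neutral_left) (use assms in \<open>auto simp: in_keys_iff\<close>)

text \<open>Cancellation can make the keys of p + q a proper subset of the union, so all three
  evaluations are summed over the union.\<close>

lemma eval_mpoly_add: "eval_mpoly (p + q) z = eval_mpoly p z + eval_mpoly q z"
proof -
  let ?K = "Poly_Mapping.keys p \<union> Poly_Mapping.keys q"
  have "Poly_Mapping.keys (p + q) \<subseteq> ?K" by (rule Poly_Mapping.keys_add)
  then show ?thesis
    by (simp add: eval_mpoly_superset[of ?K] lookup_add distrib_right sum.distrib)
qed

lemma eval_mpoly_single:
  "eval_mpoly (Poly_Mapping.single a c) z =
    c * (\<Prod>j\<in>Poly_Mapping.keys a. z j ^ Poly_Mapping.lookup a j)"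
  by (subst eval_mpoly_superset[of "{a}"]) auto

lemma eval_mpoly_sum:
  "eval_mpoly (\<Sum>x\<in>A. p x) z = (\<Sum>x\<in>A. eval_mpoly (p x) z)"
proof (induction A rule: infinite_finite_induct)
  case (insert x A)
  then show ?case by (simp add: eval_mpoly_add)
qed (simp_all add: eval_mpoly_def)

definition word_exponent :: "nat list \<Rightarrow> nat \<Rightarrow>\<^sub>0 nat" where
  "word_exponent xs = sum_list (map (\<lambda>i. Poly_Mapping.single i 1) xs)"

lemma lookup_word_exponent: "Poly_Mapping.lookup (word_exponent xs) j = count_list xs j"
  by (induction xs) (simp_all add: word_exponent_def lookup_add lookup_single when_def)

lemma keys_word_exponent: "Poly_Mapping.keys (word_exponent xs) = set xs"
  by (auto simp: in_keys_iff lookup_word_exponent count_list_0_iff)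

lemma prod_word_exponent:
  assumes "xs \<in> words m l"
  shows "(\<Prod>j\<in>Poly_Mapping.keys (word_exponent xs). z j ^ Poly_Mapping.lookup (word_exponent xs) j) =
    (\<Prod>j\<le>m. z j ^ count_list xs j :: real)"
  unfolding keys_word_exponent lookup_word_exponent
  by (rule prod.mono_neutral_left) (use assms in \<open>auto simp: words_def count_list_0_iff\<close>)

lemma Y_hat_in_R_plus_distributions:
  assumes Y: "Y \<in> borel_prob (standard_simplex m)"
  shows "Y_hat m Y l \<in> R_plus_distributions m"
proof -
  let ?S = "standard_simplex m"
  let ?c = "\<lambda>xs. word_coeff Y xs * (fact (m + (\<Sum>j\<le>m. count_list xs j)) / (\<Prod>j\<le>m. fact (count_list xs j)))"
  \<comment> \<open>Words with the same counts have the same exponent vector; adding singles merges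
    their coefficients automatically.\<close>
  define p where "p = (\<Sum>xs\<in>words m l. Poly_Mapping.single (word_exponent xs) (?c xs))"
  let ?g = "\<lambda>z. \<Sum>xs\<in>words m l. word_coeff Y xs * dirichlet_density m (count_list xs) z"
  have eval: "eval_mpoly p z = ?g z" for z
    unfolding p_def eval_mpoly_sum eval_mpoly_single
    by (rule sum.cong) (simp_all only: prod_word_exponent dirichlet_density_def mult.assoc)
  have nonneg: "0 \<le> Poly_Mapping.lookup p a" for a
    unfolding p_def lookup_sum lookup_single
    by (intro sum_nonneg)
      (auto simp: when_def intro!: mult_nonneg_nonneg divide_nonneg_nonneg prod_nonneg word_coeff_nonneg[OF Y])
  have mpoly: "p \<in> mpolys m"
  proof -
    have "Poly_Mapping.keys p \<subseteq> (\<Union>xs\<in>words m l. Poly_Mapping.keys (Poly_Mapping.single (word_exponent xs) (?c xs)))"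
      unfolding p_def by (rule Poly_Mapping.keys_sum)
    also have "\<dots> \<subseteq> word_exponent ` words m l" by (auto split: if_splits)
    finally have "Poly_Mapping.keys p \<subseteq> word_exponent ` words m l" .
    then show ?thesis
      unfolding mpolys_def by (fastforce simp: keys_word_exponent words_def)
  qed
  let ?f = "restrict (eval_mpoly p) ?S"
  have dens: "Y_hat m Y l = density (simplex_measure m) (\<lambda>z. ennreal (?f z))"
    unfolding Y_hat_eq_density[OF Y]
  proof (rule density_cong)
    show "(\<lambda>z. ennreal (?f z)) \<in> borel_measurable (simplex_measure m)"
      by (subst measurable_cong[where g="\<lambda>z. ennreal (?g z)"]) (simp_all add: eval)
    show "AE z in simplex_measure m. ennreal (?g z) = ennreal (?f z)"
      by (rule AE_I2) (simp add: eval)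
  qed simp
  interpret prob_space "Y_hat m Y l"
    using borel_probD[OF Y_hat_in_borel_prob[OF Y]] by simp
  have "(\<integral>z. 1 \<partial>Y_hat m Y l) = (\<integral>z. ?g z *\<^sub>R (1::real) \<partial>simplex_measure m)"
    unfolding Y_hat_eq_density[OF Y]
    by (rule integral_density)
      (auto intro!: AE_I2 sum_nonneg mult_nonneg_nonneg dirichlet_density_nonneg word_coeff_nonneg[OF Y])
  then have "(\<integral>z. ?g z \<partial>simplex_measure m) = 1" by (simp add: prob_space)
  moreover have "(\<integral>z. ?f z \<partial>simplex_measure m) = (\<integral>z. ?g z \<partial>simplex_measure m)"
    by (rule Bochner_Integration.integral_cong) (simp_all add: eval)
  ultimately have "?f \<in> R_plus m"
    using mpoly nonneg by (auto simp: R_plus_def R_alg_def simp del: restrict_apply)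
  then show ?thesis unfolding R_plus_distributions_def dens by blast
qed

lemma R_plus_distributions_subset: "R_plus_distributions m \<subseteq> borel_prob (standard_simplex m)"
proof
  fix L assume "L \<in> R_plus_distributions m"
  then obtain f where "f \<in> R_plus m" and Lf: "L = density (simplex_measure m) (\<lambda>z. ennreal (f z))"
    unfolding R_plus_distributions_def by blast
  then obtain p where p: "\<And>a. 0 \<le> Poly_Mapping.lookup p a"
      and f: "f = restrict (eval_mpoly p) (standard_simplex m)" and "(\<integral>z. f z \<partial>simplex_measure m) = 1"
    unfolding R_plus_def by blast
  then have L: "L = density (simplex_measure m) (\<lambda>z. ennreal (restrict (eval_mpoly p) (standard_simplex m) z))"
      and i: "(\<integral>z. restrict (eval_mpoly p) (standard_simplex m) z \<partial>simplex_measure m) = 1"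
    using Lf by simp_all
  let ?f = "restrict (eval_mpoly p) (standard_simplex m)"
  \<comment> \<open>A non-integrable function has Bochner integral 0, so the normalisation to 1
    already forces integrability.\<close>
  have int: "integrable (simplex_measure m) ?f"
    using i not_integrable_integral_eq[of "simplex_measure m" ?f] by (metis zero_neq_one)
  have nn: "0 \<le> ?f z" if "z \<in> standard_simplex m" for z
    using that p unfolding eval_mpoly_def
    by (auto intro!: sum_nonneg mult_nonneg_nonneg prod_nonneg simp: nonneg_standard_simplex)
  have meas: "(\<lambda>z. ennreal (?f z)) \<in> borel_measurable (simplex_measure m)"
    using borel_measurable_integrable[OF int] by (rule measurable_compose[OF _ measurable_ennreal])
  have "emeasure L (space L) =
      (\<integral>\<^sup>+z. ennreal (?f z) * indicator (space (simplex_measure m)) z \<partial>simplex_measure m)"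
    unfolding L using emeasure_density[OF meas sets.top] by (simp only: space_density)
  also have "\<dots> = (\<integral>\<^sup>+z. ennreal (?f z) \<partial>simplex_measure m)"
    by (rule nn_integral_cong) simp
  also have "\<dots> = ennreal (\<integral>z. ?f z \<partial>simplex_measure m)"
    by (rule nn_integral_eq_integral[OF int], rule AE_I2, rule nn) simp
  also have "\<dots> = ennreal 1" by (simp only: i)
  finally have "prob_space L" by (intro prob_spaceI) simp
  then show "L \<in> borel_prob (standard_simplex m)"
    by (simp add: borel_prob_def space_prob_algebra L)
qed

lemma weakly_dense_R_plus: "weakly_dense_on (standard_simplex m) (R_plus_distributions m)"
  unfolding weakly_dense_on_def
proof (intro conjI ballI exI)
  fix L assume L: "L \<in> borel_prob (standard_simplex m)"
  show "\<forall>l. Y_hat m L (l + 1) \<in> R_plus_distributions m"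
    using Y_hat_in_R_plus_distributions[OF L] by simp
  show "weak_conv_on (standard_simplex m) (\<lambda>l. Y_hat m L (l + 1)) L"
    by (rule weak_conv_on_Y_hat[OF L])
qed (rule R_plus_distributions_subset)

section \<open>Simplicial mixtures\<close>

lemma prob_space_uniform_simplex:
  "prob_space (uniform_measure (simplex_measure k) (standard_simplex k))"
  unfolding uniform_simplex_eq_dirichlet by (rule prob_space_dirichlet)

lemma measurable_simplex_map [measurable]:
  "simplex_map k S \<in> borel_measurable (restrict_space borel (standard_simplex k))"
proof (rule measurable_coordinatewise_then_product)
  show "(\<lambda>z. simplex_map k S z i) \<in> borel_measurable (restrict_space borel (standard_simplex k))" for i
    unfolding simplex_map_def by measurable
qed

text \<open>Valid for every multiset, even one of the wrong size, so \<open>U_simplex k\<close> is a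
  kernel on the whole discrete space under a \<open>pmf\<close>.\<close>

lemma U_simplex_in_prob_algebra: "U_simplex k S \<in> space (prob_algebra borel)"
proof -
  interpret prob_space "uniform_measure (simplex_measure k) (standard_simplex k)"
    by (rule prob_space_uniform_simplex)
  have "prob_space (U_simplex k S)"
    unfolding U_simplex_def by (rule prob_space_distr) measurable
  then show ?thesis by (simp add: space_prob_algebra U_simplex_def)
qed

lemma sets_U_simplex [simp]: "sets (U_simplex k S) = sets borel"
  by (simp add: U_simplex_def)

lemma measurable_U_simplex: "U_simplex k \<in> measure_pmf p \<rightarrow>\<^sub>M prob_algebra borel"
  using U_simplex_in_prob_algebra by auto

lemma measurable_mat_apply [measurable]:
  "mat_apply M (V :: nat \<Rightarrow> real^'n) \<in> borel \<rightarrow>\<^sub>M borel"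
  unfolding mat_apply_def[abs_def] by measurable

lemma simplicial_mixture_in_borel_prob: "simplicial_mixture k M p V \<in> borel_prob UNIV"
proof -
  have "prob_space (measure_pmf p \<bind> U_simplex k)"
    by (rule prob_space_bind'[OF _ measurable_U_simplex])
      (simp add: space_prob_algebra measure_pmf.prob_space_axioms)
  then interpret prob_space "measure_pmf p \<bind> U_simplex k" .
  have "sets (measure_pmf p \<bind> U_simplex k) = sets (borel :: (nat \<Rightarrow> real) measure)"
    by (rule sets_bind) simp_all
  then have "prob_space (simplicial_mixture k M p V)"
    unfolding simplicial_mixture_def
    by (intro prob_space_distr) (simp add: measurable_mat_apply cong: measurable_cong_sets)
  then show ?thesis
    by (simp add: borel_prob_def space_prob_algebra simplicial_mixture_def sets_restrict_UNIV)
qed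

lemma integral_simplicial_mixture:
  fixes f :: "real^'n \<Rightarrow> real"
  assumes [measurable]: "f \<in> borel_measurable borel" and B: "\<And>x. \<bar>f x\<bar> \<le> B"
  shows "(\<integral>x. f x \<partial>simplicial_mixture k M p V) =
    (\<integral>S. (\<integral>z. f (mat_apply M V (simplex_map k S z))
      \<partial>uniform_measure (simplex_measure k) (standard_simplex k)) \<partial>measure_pmf p)"
proof -
  have sets: "sets (measure_pmf p \<bind> U_simplex k) = sets (borel :: (nat \<Rightarrow> real) measure)"
    by (rule sets_bind) simp_all
  have "(\<integral>x. f x \<partial>simplicial_mixture k M p V) = (\<integral>u. f (mat_apply M V u) \<partial>(measure_pmf p \<bind> U_simplex k))"
    unfolding simplicial_mixture_def
    by (rule integral_distr) (simp_all add: measurable_mat_apply cong: measurable_cong_sets[OF sets refl])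
  also have "\<dots> = (\<integral>S. (\<integral>u. f (mat_apply M V u) \<partial>U_simplex k S) \<partial>measure_pmf p)"
  proof (rule integral_bind)
    show "(\<lambda>u. f (mat_apply M V u)) \<in> borel_measurable borel" by measurable
    show "\<bar>f (mat_apply M V u)\<bar> \<le> B" for u by (rule B)
    show "U_simplex k \<in> measure_pmf p \<rightarrow>\<^sub>M subprob_algebra borel"
      by (rule measurable_prob_algebraD[OF measurable_U_simplex])
    show "finite_measure (measure_pmf p)" by (rule measure_pmf.finite_measure)
    show "AE S in measure_pmf p. emeasure (U_simplex k S) (space (U_simplex k S)) \<le> ennreal 1"
      using U_simplex_in_prob_algebra
      by (auto simp: space_prob_algebra prob_space.emeasure_space_1 intro!: AE_I2)
  qed
  also have "\<dots> = (\<integral>S. (\<integral>z. f (mat_apply M V (simplex_map k S z))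
      \<partial>uniform_measure (simplex_measure k) (standard_simplex k)) \<partial>measure_pmf p)"
    unfolding U_simplex_def by (subst integral_distr) measurable
  finally show ?thesis .
qed

text \<open>\<open>Suc\<close> shifts the letters 0, ..., m of a word to the vertex labels 1, ..., m
  + 1 of a combinatorial simplex.\<close>

definition word_simplex :: "nat list \<Rightarrow> nat multiset" where
  "word_simplex xs = mset (map Suc xs)"

lemma word_simplex_in_comb_simplices:
  "xs \<in> words m (Suc k) \<Longrightarrow> word_simplex xs \<in> comb_simplices k (m + 1)"
  by (auto simp: word_simplex_def comb_simplices_def multisets_of_size_def words_def)

context
  fixes m k :: nat and xs :: "nat list"
  assumes xs: "xs \<in> words m (Suc k)"
begin

abbreviation (input) vertex :: "nat \<Rightarrow> nat" where
  "vertex j \<equiv> sorted_list_of_multiset (word_simplex xs) ! j"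

lemma simplex_map_word_eq_sum:
  "simplex_map k (word_simplex xs) z i = (\<Sum>j\<in>{j. j \<le> k \<and> vertex j = i}. z j)"
proof -
  have "simplex_map k (word_simplex xs) z i = (\<Sum>j\<le>k. if vertex j = i then z j else 0)"
    unfolding simplex_map_def by (rule sum.cong) auto
  also have "\<dots> = (\<Sum>j\<in>{j \<in> {..k}. vertex j = i}. z j)"
    by (rule sum.inter_filter[symmetric]) simp
  finally show ?thesis by simp
qed

lemma length_vertices: "length (sorted_list_of_multiset (word_simplex xs)) = Suc k"
proof -
  have "size (mset (sorted_list_of_multiset (word_simplex xs))) = size (word_simplex xs)"
    by (simp only: mset_sorted_list_of_multiset)
  also have "\<dots> = Suc k" using xs by (simp add: word_simplex_def words_def)
  finally show ?thesis by (simp only: size_mset)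
qed

text \<open>Sorting reorders the letters but keeps their multiplicities, so the number of positions
  mapped to a vertex is the count in the original word.\<close>

lemma card_vertex_fibre: "card {j. j \<le> k \<and> vertex j = Suc i} = count_list xs i"
proof -
  let ?ys = "sorted_list_of_multiset (word_simplex xs)"
  have "count_list xs i = count_list (map Suc xs) (Suc i)"
    by (induction xs) auto
  also have "\<dots> = count_list ?ys (Suc i)"
    by (simp add: count_mset[symmetric] word_simplex_def)
  also have "\<dots> = card {j. j < Suc k \<and> Suc i = vertex j}"
    by (simp add: count_list_eq_length_filter length_filter_conv_card length_vertices)
  also have "{j. j < Suc k \<and> Suc i = vertex j} = {j. j \<le> k \<and> vertex j = Suc i}"
    by auto
  finally show ?thesis by simp
qed

lemma vertex_range:
  assumes "j \<le> k"
  shows "vertex j \<in> Suc ` {..m}"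
proof -
  let ?ys = "sorted_list_of_multiset (word_simplex xs)"
  have "vertex j \<in> set ?ys" using assms length_vertices by (intro nth_mem) simp
  then show ?thesis using xs by (auto simp: word_simplex_def words_def)
qed

text \<open>The fibres of \<open>vertex\<close> partition the k + 1 positions, so the image
  coordinates regroup the z_j and keep their sum.\<close>

lemma simplex_map_word_in_simplex:
  assumes z: "z \<in> standard_simplex k"
  shows "(\<lambda>i. simplex_map k (word_simplex xs) z (Suc i)) \<in> standard_simplex m" (is "?w \<in> _")
proof -
  have nn: "0 \<le> ?w i" for i
    unfolding simplex_map_word_eq_sum by (rule sum_nonneg) (simp add: nonneg_standard_simplex[OF z])
  have "(\<Sum>i\<le>m. ?w i) = (\<Sum>i\<in>Suc ` {..m}. simplex_map k (word_simplex xs) z i)"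
    by (simp add: sum.reindex)
  also have "\<dots> = (\<Sum>i\<in>Suc ` {..m}. \<Sum>j\<in>{j \<in> {..k}. vertex j = i}. z j)"
    unfolding simplex_map_word_eq_sum by simp
  also have "\<dots> = (\<Sum>j\<le>k. z j)"
    using vertex_range by (intro sum.group) auto
  finally have s: "(\<Sum>i\<le>m. ?w i) = 1" using z by (simp add: standard_simplex_def)
  have zero: "?w i = 0" if "m < i" for i
  proof -
    have "{j. j \<le> k \<and> vertex j = Suc i} = {}" using vertex_range that by fastforce
    then show ?thesis by (simp only: simplex_map_word_eq_sum sum.empty)
  qed
  have "?w i \<le> 1" for i
  proof (cases "i \<le> m")
    case True
    then have "?w i \<le> (\<Sum>i\<le>m. ?w i)" using nn by (intro member_le_sum) auto
    then show ?thesis using s by simp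
  next
    case False
    then show ?thesis using zero[of i] by simp
  qed
  then show ?thesis using nn zero s by (simp add: standard_simplex_def)
qed

lemma has_bochner_integral_simplex_map_word_fst:
  "has_bochner_integral (uniform_measure (simplex_measure k) (standard_simplex k))
    (\<lambda>z. simplex_map k (word_simplex xs) z (Suc i)) (real (count_list xs i) / (real k + 1))"
  unfolding simplex_map_word_eq_sum card_vertex_fibre[symmetric]
  by (rule has_bochner_integral_uniform_simplex_sum_fst) auto

lemma has_bochner_integral_simplex_map_word_snd:
  "has_bochner_integral (uniform_measure (simplex_measure k) (standard_simplex k))
    (\<lambda>z. (simplex_map k (word_simplex xs) z (Suc i))\<^sup>2)
    (real (count_list xs i) * (real (count_list xs i) + 1) / ((real k + 1) * (real k + 2)))"
  unfolding simplex_map_word_eq_sum card_vertex_fibre[symmetric]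
  by (rule has_bochner_integral_uniform_simplex_sum_snd) auto

end

section \<open>Mixing simplices over random words\<close>

definition word_pmf :: "nat \<Rightarrow> nat \<Rightarrow> (nat \<Rightarrow> real) measure \<Rightarrow> nat list pmf" where
  "word_pmf m l Y = embed_pmf (\<lambda>xs. if xs \<in> words m l then word_coeff Y xs else 0)"

text \<open>The weights sum to 1 because, after exchanging sum and integral, the word probabilities
  sum to 1 for every y in the simplex.\<close>

lemma pmf_word_pmf:
  assumes Y: "Y \<in> borel_prob (standard_simplex m)"
  shows "pmf (word_pmf m l Y) xs = (if xs \<in> words m l then word_coeff Y xs else 0)"
  unfolding word_pmf_def
proof (rule pmf_embed_pmf)
  interpret prob_space Y using borel_probD[OF Y] by simp
  note [measurable_cong] = borel_probD(2)[OF Y]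
  have "(\<integral>\<^sup>+xs. ennreal (if xs \<in> words m l then word_coeff Y xs else 0) \<partial>count_space UNIV) =
      (\<Sum>xs\<in>words m l. ennreal (if xs \<in> words m l then word_coeff Y xs else 0))"
    by (rule nn_integral_count_space'[of "words m l"]) auto
  also have "\<dots> = (\<Sum>xs\<in>words m l. \<integral>\<^sup>+y. ennreal (word_prob y xs) \<partial>Y)"
    by (rule sum.cong) (simp_all add: nn_integral_word_prob[OF Y])
  also have "\<dots> = (\<integral>\<^sup>+y. (\<Sum>xs\<in>words m l. ennreal (word_prob y xs)) \<partial>Y)"
    by (rule nn_integral_sum[symmetric]) measurable
  also have "\<dots> = (\<integral>\<^sup>+y. 1 \<partial>Y)"
  proof (rule nn_integral_cong)
    fix y assume "y \<in> space Y"
    then have "\<And>i. 0 \<le> y i" "(\<Sum>i\<le>m. y i) = 1"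
      using borel_probD(3)[OF Y] by (auto simp: standard_simplex_def)
    then show "(\<Sum>xs\<in>words m l. ennreal (word_prob y xs)) = 1"
      by (subst sum_ennreal) (auto simp: word_prob_nonneg sum_word_prob)
  qed
  finally show "(\<integral>\<^sup>+xs. ennreal (if xs \<in> words m l then word_coeff Y xs else 0) \<partial>count_space UNIV) = 1"
    by (simp add: emeasure_space_1)
qed (simp add: word_coeff_nonneg[OF Y])

text \<open>The vertices V stay fixed along the sequence; only the dimension k and the weights
  change. The shift \<open>i - 1\<close> matches simplex coordinates, which start at 0, with
  columns, which start at 1.\<close>

lemma simplicial_mixture_weak_conv:
  fixes V :: "nat \<Rightarrow> real^'n"
  assumes Y: "Y \<in> borel_prob (standard_simplex m)"
  defines "p \<equiv> \<lambda>k. map_pmf word_simplex (word_pmf m (Suc k) Y)"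
  shows "set_pmf (p k) \<subseteq> comb_simplices k (m + 1)"
    and "weak_conv_on UNIV (\<lambda>k. simplicial_mixture k (m + 1) (p k) V)
      (distr Y borel (\<lambda>u. mat_apply (m + 1) V (\<lambda>i. u (i - 1))))"
proof -
  have set_pmf: "set_pmf (word_pmf m l Y) \<subseteq> words m l" for l
    by (auto simp: set_pmf_eq pmf_word_pmf[OF Y] split: if_splits)
  then show "set_pmf (p k) \<subseteq> comb_simplices k (m + 1)" for k
    unfolding p_def set_map_pmf using word_simplex_in_comb_simplices by blast
  interpret prob_space Y using borel_probD[OF Y] by simp
  note [measurable_cong] = borel_probD(2)[OF Y]
  let ?T = "\<lambda>u. mat_apply (m + 1) V (\<lambda>i. u (i - 1))"
  have T_eq: "?T = (\<lambda>u. \<Sum>i=1..m + 1. u (i - 1) *\<^sub>R V i)" by (simp add: mat_apply_def)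
  have T_borel [measurable]: "?T \<in> borel_measurable borel" unfolding T_eq by measurable
  have T [measurable]: "?T \<in> borel_measurable (restrict_space borel (standard_simplex m))"
    by (rule measurable_restrict_space1[OF T_borel])
  have cont_T: "continuous_on (standard_simplex m) ?T"
    unfolding T_eq by (intro continuous_intros continuous_on_component)
  show "weak_conv_on UNIV (\<lambda>k. simplicial_mixture k (m + 1) (p k) V) (distr Y borel ?T)"
    unfolding weak_conv_on_def
  proof (intro conjI allI impI)
    have "prob_space (distr Y borel ?T)" by (rule prob_space_distr) measurable
    then show "distr Y borel ?T \<in> borel_prob UNIV"
      by (simp add: borel_prob_def space_prob_algebra sets_restrict_UNIV)
    show "simplicial_mixture k (m + 1) (p k) V \<in> borel_prob UNIV" for k
      by (rule simplicial_mixture_in_borel_prob)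
    fix f :: "real^'n \<Rightarrow> real" assume f: "continuous_on UNIV f" and "bounded (range f)"
    then obtain B where B: "\<And>x. \<bar>f x\<bar> \<le> B" unfolding bounded_iff by auto
    have f_meas [measurable]: "f \<in> borel_measurable borel" using f by (rule borel_measurable_continuous_onI)
    let ?U = "\<lambda>k. uniform_measure (simplex_measure k) (standard_simplex k)"
    let ?Z = "\<lambda>k xs z i. simplex_map k (word_simplex xs) z (Suc i)"
    \<comment> \<open>\<open>mat_apply\<close> reads only indices i >= 1, where
      \<open>Suc (i - 1)\<close> is i.\<close>
    have cong: "mat_apply (m + 1) V (simplex_map k (word_simplex xs) z) = ?T (?Z k xs z)" for k xs z
      unfolding mat_apply_def by (rule sum.cong) auto
    have "(\<lambda>k. \<Sum>xs\<in>words m (Suc k). expectation (\<lambda>y. word_prob y xs) *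
        (\<integral>z. f (?T (?Z k xs z)) \<partial>?U k)) \<longlonglongrightarrow> expectation (\<lambda>y. f (?T y))"
    \<comment> \<open>Here the moments are c / (k + 1) and c (c + 1) / ((k + 1) (k + 2)) with c the
      count, so no shift occurs: s = r = 0, and the total is the word length k + 1.\<close>
    proof (rule word_mixture_tendsto[where Z="?Z" and s=0 and r=0 and f="\<lambda>y. f (?T y)"])
      show "continuous_on (standard_simplex m) (\<lambda>y. f (?T y))"
        by (rule continuous_on_compose2[OF f cont_T]) simp
      show "(\<lambda>y. f (?T y)) \<in> borel_measurable Y" by measurable
      fix k xs assume xs: "xs \<in> words m (Suc k)"
      show "prob_space (?U k)" by (rule prob_space_uniform_simplex)
      show "?Z k xs z \<in> standard_simplex m" if "z \<in> space (?U k)" for z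
        using that by (intro simplex_map_word_in_simplex[OF xs]) simp
      show "(\<lambda>z. f (?T (?Z k xs z))) \<in> borel_measurable (?U k)"
        unfolding cong[symmetric] by measurable
      show "has_bochner_integral (?U k) (\<lambda>z. ?Z k xs z i)
          ((real (count_list xs i) + 0) / (real (Suc k) + 0))" for i
        using has_bochner_integral_simplex_map_word_fst[OF xs, of i] by (simp add: add.commute)
      show "has_bochner_integral (?U k) (\<lambda>z. (?Z k xs z i)\<^sup>2)
          ((real (count_list xs i) + 0) * (real (count_list xs i) + 0 + 1) /
            ((real (Suc k) + 0) * (real (Suc k) + 0 + 1)))" for i
        using has_bochner_integral_simplex_map_word_snd[OF xs, of i] by (simp add: add_ac)
    qed (use borel_probD(3)[OF Y] in auto)
    moreover have "(\<integral>x. f x \<partial>simplicial_mixture k (m + 1) (p k) V) =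
        (\<Sum>xs\<in>words m (Suc k). expectation (\<lambda>y. word_prob y xs) * (\<integral>z. f (?T (?Z k xs z)) \<partial>?U k))" for k
    proof -
      have "(\<integral>x. f x \<partial>simplicial_mixture k (m + 1) (p k) V) =
          (\<integral>xs. (\<integral>z. f (?T (?Z k xs z)) \<partial>?U k) \<partial>measure_pmf (word_pmf m (Suc k) Y))"
        by (subst integral_simplicial_mixture[OF f_meas B]) (simp only: p_def integral_map_pmf cong)
      also have "\<dots> = (\<Sum>xs\<in>words m (Suc k). pmf (word_pmf m (Suc k) Y) xs *\<^sub>R
          (\<integral>z. f (?T (?Z k xs z)) \<partial>?U k))"
        using set_pmf by (intro integral_measure_pmf) auto
      finally show ?thesis by (simp add: pmf_word_pmf[OF Y] word_coeff_def)
    qed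
    moreover have "(\<integral>x. f x \<partial>distr Y borel ?T) = expectation (\<lambda>y. f (?T y))"
      by (rule integral_distr) measurable
    ultimately show "(\<lambda>k. \<integral>x. f x \<partial>simplicial_mixture k (m + 1) (p k) V) \<longlonglongrightarrow>
        (\<integral>x. f x \<partial>distr Y borel ?T)"
      by (simp only:)
  qed
qed

section \<open>Barycentric coordinates for a bounded set\<close>

lemma bounded_set_in_simplex:
  fixes R :: real
  assumes "0 < R"
  obtains y :: "real^'n \<Rightarrow> nat \<Rightarrow> real" and V :: "nat \<Rightarrow> real^'n"
  where "\<And>x. y x \<in> standard_simplex CARD('n)" "y \<in> borel_measurable borel"
    "\<And>x. norm x \<le> R \<Longrightarrow> mat_apply (CARD('n) + 1) V (\<lambda>i. y x (i - 1)) = x"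
proof -
  let ?n = "CARD('n)"
  obtain idx :: "nat \<Rightarrow> 'n" where idx: "bij_betw idx {1..?n} UNIV"
    using ex_bij_betw_nat_finite_1[OF finite[of UNIV]] by blast
  \<comment> \<open>Each x_i + R is at most 2 R on the box, so this edge length makes the n
    coordinates \<open>b x j\<close> at most 1/n each and their sum at most 1.\<close>
  define T where "T = 2 * R * real ?n"
  have T: "0 < T" using assms by (simp add: T_def)
  define b where "b x j = (x $ idx j + R) / T" for x :: "real^'n" and j
  \<comment> \<open>Off the box all mass goes to coordinate 0, so that y maps the whole space into
    the simplex.\<close>
  define y where "y x j = (if \<forall>i. \<bar>x $ i\<bar> \<le> R
      then if j = 0 then 1 - (\<Sum>j=1..?n. b x j) else if j \<le> ?n then b x j else 0
      else if j = 0 then 1 else 0)" for x :: "real^'n" and j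
  \<comment> \<open>The vertices are the corner (-R, ..., -R) and its translates by T along the
    axes: a simplex with n + 1 vertices containing the box.\<close>
  define V :: "nat \<Rightarrow> real^'n" where
    "V k = (\<chi> i. - R) + (if k = 1 then 0 else axis (idx (k - 1)) T)" for k
  have ins: "{..?n} = insert 0 {1..?n}" by auto
  have in_simplex: "y x \<in> standard_simplex ?n" for x
  proof (cases "\<forall>i. \<bar>x $ i\<bar> \<le> R")
    case False
    then have "y x = (\<lambda>j. if j = 0 then 1 else 0)"
      by (intro ext) (simp only: y_def if_not_P[OF False] if_False)
    then show ?thesis by simp
  next
    case True
    have b: "0 \<le> b x j" "b x j \<le> 1 / real ?n" for j
    proof -
      have "- R \<le> x $ idx j" "x $ idx j \<le> R" using True[rule_format, of "idx j"] by auto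
      then show "0 \<le> b x j" "b x j \<le> 1 / real ?n"
        using T assms by (simp_all add: b_def T_def field_simps)
    qed
    have b1: "(\<Sum>j=1..?n. b x j) \<le> 1"
      using sum_mono[of "{1..?n}" "b x" "\<lambda>_. 1 / real ?n"] b by simp
    have b0: "0 \<le> (\<Sum>j=1..?n. b x j)" using b by (intro sum_nonneg) auto
    have "b x j \<le> 1" for j using b(2)[of j] by (rule order_trans) simp
    moreover have "(\<Sum>j\<le>?n. y x j) = 1"
      using True by (simp add: ins y_def)
    ultimately show ?thesis
      using True b b0 b1 by (auto simp: standard_simplex_def y_def)
  qed
  have meas: "y \<in> borel_measurable borel"
  proof (rule measurable_coordinatewise_then_product)
    have [measurable]: "(\<lambda>x::real^'n. x $ i) \<in> borel_measurable borel" for i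
      by (intro borel_measurable_continuous_onI continuous_intros)
    show "(\<lambda>x. y x j) \<in> borel_measurable borel" for j
      unfolding y_def b_def by measurable
  qed
  have "mat_apply (?n + 1) V (\<lambda>i. y x (i - 1)) = x" if "norm x \<le> R" for x
  proof (rule vec_eq_iff[THEN iffD2], rule allI)
    fix i
    have box: "\<forall>i. \<bar>x $ i\<bar> \<le> R" using component_le_norm_cart[of x] that by (meson order_trans)
    obtain k where k: "k \<in> {1..?n}" "idx k = i"
      using idx by (metis bij_betw_iff_bijections iso_tuple_UNIV_I)
    have ax: "axis (idx j) T $ i = (if j = k then T else 0)" if "j \<in> {1..?n}" for j
      using inj_on_eq_iff[OF bij_betw_imp_inj_on[OF idx] that k(1)] k(2) by (auto simp: axis_def)
    have V_nth: "V (Suc j) $ i = - R + (if j = 0 then 0 else axis (idx j) T $ i)" for j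
      by (simp add: V_def)
    have "mat_apply (?n + 1) V (\<lambda>i. y x (i - 1)) = (\<Sum>j\<le>?n. y x j *\<^sub>R V (Suc j))"
      unfolding mat_apply_def
      by (rule sum.reindex_bij_witness[of _ Suc "\<lambda>i. i - 1"]) auto
    also have "\<dots> $ i = (\<Sum>j\<le>?n. y x j * (- R)) +
        (\<Sum>j\<le>?n. y x j * (if j = 0 then 0 else axis (idx j) T $ i))"
      by (simp only: sum_component vector_scaleR_component real_scaleR_def V_nth distrib_left sum.distrib)
    also have "(\<Sum>j\<le>?n. y x j * (- R)) = - R"
      using in_simplex[of x] by (simp add: sum_distrib_right[symmetric] standard_simplex_def sum_negf)
    also have "(\<Sum>j\<le>?n. y x j * (if j = 0 then 0 else axis (idx j) T $ i)) =
        (\<Sum>j\<in>{1..?n}. y x j * (if j = k then T else 0))"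
      by (simp add: ins) (rule sum.cong, auto simp: ax)
    also have "\<dots> = (\<Sum>j\<in>{1..?n}. if j = k then y x j * T else 0)"
      by (rule sum.cong) auto
    also have "\<dots> = y x k * T" using k by simp
    also have "\<dots> = x $ i + R" using k box T by (simp add: y_def b_def)
    finally show "mat_apply (?n + 1) V (\<lambda>i. y x (i - 1)) $ i = x $ i" by simp
  qed
  with in_simplex meas show ?thesis by (rule that)
qed

text \<open>The complement of the support is the union of all open null sets; second countability
  reduces it to a countable union, which is null.\<close>

lemma AE_measure_support:
  fixes L :: "'a::second_countable_topology measure"
  assumes "sets L = sets borel"
  shows "AE x in L. x \<in> measure_support L"
proof -
  define \<U> where "\<U> = {U. open U \<and> emeasure L U = 0}"
  obtain \<U>' where U': "\<U>' \<subseteq> \<U>" "countable \<U>'" "\<Union>\<U>' = \<Union>\<U>"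
    using Lindelof[of \<U>] by (auto simp: \<U>_def)
  have null: "U \<in> null_sets L" if "U \<in> \<U>'" for U
    using that U'(1) by (auto simp: \<U>_def null_sets_def assms)
  have "\<Union>\<U>' \<in> null_sets L"
    using null_sets_UN'[OF U'(2), of "\<lambda>U. U" L] null by simp
  then have "AE x in L. x \<notin> \<Union>\<U>" unfolding U' by (rule AE_not_in)
  then show ?thesis
  proof eventually_elim
    fix x assume x: "x \<notin> \<Union>\<U>"
    show "x \<in> measure_support L"
      unfolding measure_support_def
    proof safe
      fix U assume "open U" "x \<in> U"
      with x show "0 < emeasure L U" by (auto simp: \<U>_def zero_less_iff_neq_zero)
    qed
  qed
qed

text \<open>Barycentric coordinates push X to a distribution Y on a simplex, and the affine map with
  vertices V carries Y back to X; approximating Y by words then approximates X.\<close>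

lemma bounded_support_approximable:
  fixes X :: "(real^'n) measure"
  assumes X: "X \<in> borel_prob UNIV" and "bounded (measure_support X)"
  shows "\<exists>N. (\<forall>i. N i \<in> simplicial_mixture_models (CARD('n) + 1)) \<and> weak_conv_on UNIV N X"
proof -
  let ?n = "CARD('n)"
  obtain R where R: "0 < R" "\<And>x. x \<in> measure_support X \<Longrightarrow> norm x \<le> R"
    using assms(2) unfolding bounded_pos by blast
  obtain y :: "real^'n \<Rightarrow> nat \<Rightarrow> real" and V :: "nat \<Rightarrow> real^'n"
    where y: "\<And>x. y x \<in> standard_simplex ?n" "y \<in> borel_measurable borel"
    and V: "\<And>x. norm x \<le> R \<Longrightarrow> mat_apply (?n + 1) V (\<lambda>i. y x (i - 1)) = x"
    by (rule bounded_set_in_simplex[OF R(1), where ?'n='n]) (rule that)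
  let ?N = "restrict_space borel (standard_simplex ?n)"
  let ?T = "\<lambda>u. mat_apply (?n + 1) V (\<lambda>i. u (i - 1))"
  interpret prob_space X using borel_probD[OF X] by simp
  have sets_X [measurable_cong]: "sets X = sets borel"
    using borel_probD(2)[OF X] by (simp add: sets_restrict_UNIV)
  have yN: "y \<in> X \<rightarrow>\<^sub>M ?N"
    using y by (intro measurable_restrict_space2) (simp_all add: measurable_cong_sets[OF sets_X refl])
  define Y where "Y = distr X ?N y"
  have "prob_space Y" unfolding Y_def by (rule prob_space_distr[OF yN])
  then have Y: "Y \<in> borel_prob (standard_simplex ?n)"
    by (simp add: borel_prob_def space_prob_algebra Y_def)
  have T: "?T \<in> ?N \<rightarrow>\<^sub>M borel"
    unfolding mat_apply_def by (intro borel_measurable_sum borel_measurable_scaleR) measurable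
  have "distr Y borel ?T = distr X borel (\<lambda>x. ?T (y x))"
    unfolding Y_def distr_distr[OF T yN] comp_def ..
  also have "\<dots> = distr X borel (\<lambda>x. x)"
  proof (rule distr_cong_AE)
    \<comment> \<open>Coordinates invert the affine map only on the ball of radius R, which contains
      the support and hence almost every point.\<close>
    show "AE x in X. ?T (y x) = x"
      using AE_measure_support[OF sets_X] by eventually_elim (rule V[OF R(2)])
    show "(\<lambda>x. ?T (y x)) \<in> borel_measurable X" by (rule measurable_compose[OF yN T])
  qed (simp_all add: measurable_ident_sets[OF sets_X])
  also have "\<dots> = X" by (rule distr_id2) (rule sets_X[symmetric])
  finally have "distr Y borel ?T = X" .
  then have "weak_conv_on UNIV
      (\<lambda>k. simplicial_mixture k (?n + 1) (map_pmf word_simplex (word_pmf ?n (Suc k) Y)) V) X"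
    using simplicial_mixture_weak_conv(2)[OF Y, of V] by simp
  moreover have "simplicial_mixture k (?n + 1) (map_pmf word_simplex (word_pmf ?n (Suc k) Y)) V
      \<in> simplicial_mixture_models (?n + 1)" for k
    unfolding simplicial_mixture_models_def using simplicial_mixture_weak_conv(1)[OF Y]
    by (intro CollectI exI conjI) (rule refl)
  ultimately show ?thesis by (intro exI conjI allI)
qed

theorem theorem4p2:
  fixes m :: nat
  shows "(\<forall>Y \<in> borel_prob (standard_simplex m).
            weak_conv_on (standard_simplex m) (\<lambda>l. Y_hat m Y (l + 1)) Y) \<and>
         weakly_dense_on (standard_simplex m) (R_plus_distributions m) \<and>
         (\<forall>X \<in> borel_prob (UNIV :: (real^'n) set).
            bounded (measure_support X) \<longrightarrow>
            (\<exists>N. (\<forall>i. N i \<in> simplicial_mixture_models (CARD('n) + 1)) \<and>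
                 weak_conv_on UNIV N X))"
  using weak_conv_on_Y_hat weakly_dense_R_plus bounded_support_approximable
  by (intro conjI ballI impI)

end
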